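(* Let $H$ be a colored graph such that $\widehat H$ has treewidth at most $w$ and $H$ has no $c$-flower centered at any of its color classes. Then one can compute a guarded cutvertex decomposition $(T,\beta,g)$ of $H$ with guard size $O((w+c)^2w^2)$ such that every bag contains vertices of at most $O((c+w)w)$ colors.
   Context: A colored graph is a finite simple graph $H$ with a (not necessarily proper) vertex coloring with color classes $C_i$. $\widehat H$ is the simple graph with one vertex per color class, two being adjacent iff $H$ has an edge between the classes. $H^{\bullet}$ is obtained from $H$ by making every color class a clique; $H^{\bullet\setminus i}$ by making every color class except $C_i$ a clique. A $c$-flower centered at $C_i$ is a collection of $c$ pairwise vertex-disjoint paths of length at least $1$ in $H^{\bullet\setminus i}$, each with both endpoints in $C_i$. For a rooted tree decomposition $(T,\beta)$, $\sigma(t)=\beta(t)\cap\beta(\text{parent}(t))$ and $\sigma(\text{root})=\emptyset$. A guarded cutvertex decomposition of $H$ is $(T,\beta,g)$ with $(T,\beta)$ a rooted tree decomposition of $H^{\bullet}$ and $\sigma(t)\subseteq g(t)\subseteq\beta(t)$ for all $t$, such that $g(t)$ is a vertex cover of $H[\beta(t)]$ for every $t$, and $|\sigma(t')\setminus g(t)|\le1$ for every $t$ and child $t'$ of $t$. The guard size is $\max_t|g(t)|$.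
   Formalization: The formal theorem assumes w ≥ 1: for w = 0 the stated bounds are 0 and fail already for a one-vertex H with c = 1; graphs with treewidth 0 are covered by taking w = 1. *)

theory Defs
  imports Main "HOL-Library.Nat_Bijection"
begin

section \<open>Graphs, trees and tree decompositions\<close>

record 'a ugraph =
  verts :: "'a set"
  edges :: "'a set set"

definition simple_graph :: "'a ugraph \<Rightarrow> bool" where
  "simple_graph G \<longleftrightarrow> finite (verts G) \<and> (\<forall>e\<in>edges G. e \<subseteq> verts G \<and> card e = 2)"

definition induced :: "'a ugraph \<Rightarrow> 'a set \<Rightarrow> 'a ugraph" where
  "induced G S = \<lparr>verts = S, edges = {e \<in> edges G. e \<subseteq> S}\<rparr>"

text \<open>A path is its list of (distinct) vertices; its length is \<open>length p - 1\<close>.\<close>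

definition is_path :: "'a ugraph \<Rightarrow> 'a list \<Rightarrow> bool" where
  "is_path G p \<longleftrightarrow> p \<noteq> [] \<and> distinct p \<and> set p \<subseteq> verts G \<and>
     successively (\<lambda>u v. {u, v} \<in> edges G) p"

definition connected_graph :: "'a ugraph \<Rightarrow> bool" where
  "connected_graph G \<longleftrightarrow>
     (\<forall>u\<in>verts G. \<forall>v\<in>verts G. \<exists>p. is_path G p \<and> hd p = u \<and> last p = v)"

definition acyclic_graph :: "'a ugraph \<Rightarrow> bool" where
  "acyclic_graph G \<longleftrightarrow>
     \<not> (\<exists>p. is_path G p \<and> 3 \<le> length p \<and> {last p, hd p} \<in> edges G)"

definition is_tree :: "'a ugraph \<Rightarrow> bool" where
  "is_tree T \<longleftrightarrow> simple_graph T \<and> verts T \<noteq> {} \<and> connected_graph T \<and> acyclic_graph T"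

definition tree_decomposition :: "'a ugraph \<Rightarrow> 't ugraph \<Rightarrow> ('t \<Rightarrow> 'a set) \<Rightarrow> bool" where
  "tree_decomposition G T \<beta> \<longleftrightarrow> is_tree T \<and>
     (\<forall>t\<in>verts T. \<beta> t \<subseteq> verts G) \<and>
     (\<forall>v\<in>verts G. \<exists>t\<in>verts T. v \<in> \<beta> t) \<and>
     (\<forall>e\<in>edges G. \<exists>t\<in>verts T. e \<subseteq> \<beta> t) \<and>
     (\<forall>v\<in>verts G. connected_graph (induced T {t \<in> verts T. v \<in> \<beta> t}))"

definition width :: "'t ugraph \<Rightarrow> ('t \<Rightarrow> 'a set) \<Rightarrow> nat" where
  "width T \<beta> = Max ((\<lambda>t. card (\<beta> t)) ` verts T) - 1"

text \<open>
  Tree nodes are natural numbers, which is no restriction since trees are finite.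
  As the subtraction in \<open>width\<close> is truncated, the graph without vertices gets treewidth
  0 (and not -1).
\<close>

definition treewidth :: "'a ugraph \<Rightarrow> nat" where
  "treewidth G = (LEAST k. \<exists>(T :: nat ugraph) \<beta>. tree_decomposition G T \<beta> \<and> width T \<beta> = k)"

definition vertex_cover :: "'a ugraph \<Rightarrow> 'a set \<Rightarrow> bool" where
  "vertex_cover G S \<longleftrightarrow> S \<subseteq> verts G \<and> (\<forall>e\<in>edges G. e \<inter> S \<noteq> {})"

text \<open>The parent of \<open>t\<close> is the last but one vertex of the path from the root \<open>r\<close> to \<open>t\<close>.\<close>

definition parent :: "'t ugraph \<Rightarrow> 't \<Rightarrow> 't \<Rightarrow> 't" where
  "parent T r t = (THE s. \<exists>p. is_path T (p @ [s, t]) \<and> hd (p @ [s, t]) = r)"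

definition is_child :: "'t ugraph \<Rightarrow> 't \<Rightarrow> 't \<Rightarrow> 't \<Rightarrow> bool" where
  "is_child T r t' t \<longleftrightarrow> t' \<in> verts T \<and> t' \<noteq> r \<and> parent T r t' = t"

definition adhesion :: "'t ugraph \<Rightarrow> 't \<Rightarrow> ('t \<Rightarrow> 'a set) \<Rightarrow> 't \<Rightarrow> 'a set" where
  "adhesion T r \<beta> t = (if t = r then {} else \<beta> t \<inter> \<beta> (parent T r t))"


section \<open>Colored graphs\<close>

text \<open>
  A colored graph is a graph \<open>H\<close> with an arbitrary function \<open>col\<close>, of which only the values on
  \<open>verts H\<close> matter. The color classes are indexed by the colors in use, so they are nonempty.
\<close>

definition colors :: "'a ugraph \<Rightarrow> ('a \<Rightarrow> 'c) \<Rightarrow> 'c set" where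
  "colors H col = col ` verts H"

definition color_class :: "'a ugraph \<Rightarrow> ('a \<Rightarrow> 'c) \<Rightarrow> 'c \<Rightarrow> 'a set" where
  "color_class H col i = {v \<in> verts H. col v = i}"

definition hat :: "'a ugraph \<Rightarrow> ('a \<Rightarrow> 'c) \<Rightarrow> 'c ugraph" where
  "hat H col = \<lparr>verts = colors H col,
     edges = {{i, j} | i j. i \<noteq> j \<and>
       (\<exists>u\<in>color_class H col i. \<exists>v\<in>color_class H col j. {u, v} \<in> edges H)}\<rparr>"

definition make_cliques :: "'a ugraph \<Rightarrow> 'a set set \<Rightarrow> 'a ugraph" where
  "make_cliques H \<C> = \<lparr>verts = verts H,
     edges = edges H \<union> {{u, v} | u v. u \<noteq> v \<and> (\<exists>C\<in>\<C>. u \<in> C \<and> v \<in> C)}\<rparr>"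

definition bullet :: "'a ugraph \<Rightarrow> ('a \<Rightarrow> 'c) \<Rightarrow> 'a ugraph" where
  "bullet H col = make_cliques H (color_class H col ` colors H col)"

definition bullet_except :: "'a ugraph \<Rightarrow> ('a \<Rightarrow> 'c) \<Rightarrow> 'c \<Rightarrow> 'a ugraph" where
  "bullet_except H col i = make_cliques H (color_class H col ` (colors H col - {i}))"

definition is_flower :: "'a ugraph \<Rightarrow> ('a \<Rightarrow> 'c) \<Rightarrow> nat \<Rightarrow> 'c \<Rightarrow> 'a list set \<Rightarrow> bool" where
  "is_flower H col c i P \<longleftrightarrow> finite P \<and> card P = c \<and>
     (\<forall>p\<in>P. is_path (bullet_except H col i) p \<and> 2 \<le> length p \<and>
        hd p \<in> color_class H col i \<and> last p \<in> color_class H col i) \<and>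
     (\<forall>p\<in>P. \<forall>q\<in>P. p \<noteq> q \<longrightarrow> set p \<inter> set q = {})"

definition guarded_cutvertex_decomposition ::
  "'a ugraph \<Rightarrow> ('a \<Rightarrow> 'c) \<Rightarrow> 't ugraph \<Rightarrow> 't \<Rightarrow> ('t \<Rightarrow> 'a set) \<Rightarrow> ('t \<Rightarrow> 'a set) \<Rightarrow> bool" where
  "guarded_cutvertex_decomposition H col T r \<beta> g \<longleftrightarrow>
     tree_decomposition (bullet H col) T \<beta> \<and> r \<in> verts T \<and>
     (\<forall>t\<in>verts T. adhesion T r \<beta> t \<subseteq> g t \<and> g t \<subseteq> \<beta> t) \<and>
     (\<forall>t\<in>verts T. vertex_cover (induced H (\<beta> t)) (g t)) \<and>
     (\<forall>t\<in>verts T. \<forall>t'. is_child T r t' t \<longrightarrow> card (adhesion T r \<beta> t' - g t) \<le> 1)"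

definition guard_size :: "'t ugraph \<Rightarrow> ('t \<Rightarrow> 'a set) \<Rightarrow> nat" where
  "guard_size T g = Max ((\<lambda>t. card (g t)) ` verts T)"


section \<open>Computability\<close>

text \<open>
  Algorithms are programs for partial recursive functions; \<open>computes f xs y\<close> means that
  \<open>f\<close> halts on input \<open>xs\<close> with output \<open>y\<close>. In \<open>PRec\<close> and \<open>Mu\<close> the recursion (search) variable is
  the first argument.
\<close>

datatype prog =
    Zero
  | Succ
  | Proj nat
  | Comp prog "prog list"
  | PRec prog prog
  | Mu prog

inductive computes :: "prog \<Rightarrow> nat list \<Rightarrow> nat \<Rightarrow> bool" where
  "computes Zero xs 0"
| "computes Succ [x] (Suc x)"
| "i < length xs \<Longrightarrow> computes (Proj i) xs (xs ! i)"
| "list_all2 (\<lambda>g y. computes g xs y) gs ys \<Longrightarrow> computes f ys z \<Longrightarrow> computes (Comp f gs) xs z"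
| "computes f xs y \<Longrightarrow> computes (PRec f g) (0 # xs) y"
| "computes (PRec f g) (n # xs) y \<Longrightarrow> computes g (n # y # xs) z \<Longrightarrow>
     computes (PRec f g) (Suc n # xs) z"
| "computes f (n # xs) 0 \<Longrightarrow> (\<forall>m<n. \<exists>y. computes f (m # xs) (Suc y)) \<Longrightarrow> computes (Mu f) xs n"

inductive_cases computes_ZeroE: "computes Zero xs z"
inductive_cases computes_SuccE: "computes Succ xs z"
inductive_cases computes_ProjE: "computes (Proj i) xs z"
inductive_cases computes_CompE: "computes (Comp f gs) xs z"
inductive_cases computes_PRec0E: "computes (PRec f g) (0 # xs) z"
inductive_cases computes_PRecSucE: "computes (PRec f g) (Suc n # xs) z"
inductive_cases computes_MuE: "computes (Mu f) xs z"

lemma computes_deterministic: "computes f xs y \<Longrightarrow> computes f xs z \<Longrightarrow> y = z"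
proof (induction arbitrary: z rule: computes.induct)
  case (4 xs gs ys f y)
  from 4(4) obtain zs where zs: "list_all2 (\<lambda>g y. computes g xs y) gs zs" "computes f zs z"
    by (rule computes_CompE)
  have "ys = zs"
    using 4(1) zs(1) by (auto simp: list_all2_conv_all_nth intro!: nth_equalityI)
  with 4(2) zs(2) show ?case by blast
next
  case (6 f g n xs y z')
  from "6.prems" show ?case by (rule computes_PRecSucE) (metis "6.IH")
next
  case (7 f n xs)
  from "7.prems" have z: "computes f (z # xs) 0" "\<forall>m<z. \<exists>y. computes f (m # xs) (Suc y)"
    by (rule computes_MuE, blast)+
  have "\<not> z < n"
  proof
    assume "z < n"
    with 7(3) obtain y where "\<forall>x. computes f (z # xs) x \<longrightarrow> Suc y = x" by auto
    with z(1) show False by auto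
  qed
  moreover have "\<not> n < z"
  proof
    assume "n < z"
    with z(2) obtain y where "computes f (n # xs) (Suc y)" by blast
    then have "0 = Suc y" by (rule 7(2))
    then show False by simp
  qed
  ultimately show ?case by simp
next
  case 1
  then show ?case by (rule computes_ZeroE) simp
next
  case 2
  then show ?case by (rule computes_SuccE) simp
next
  case (3 i xs)
  from "3.prems" show ?case by (rule computes_ProjE) simp
next
  case 5
  from "5.prems" show ?case by (rule computes_PRec0E) (rule "5.IH")
qed

text \<open>Finite objects over the natural numbers as single numbers, for the input and the output.\<close>

definition encode_graph :: "nat ugraph \<Rightarrow> nat" where
  "encode_graph G = prod_encode (set_encode (verts G),
     set_encode {prod_encode (u, v) | u v. {u, v} \<in> edges G})"

definition encode_map :: "nat set \<Rightarrow> (nat \<Rightarrow> nat) \<Rightarrow> nat" where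
  "encode_map A f = set_encode ((\<lambda>x. prod_encode (x, f x)) ` A)"

definition encode_colored_graph :: "nat ugraph \<Rightarrow> (nat \<Rightarrow> nat) \<Rightarrow> nat" where
  "encode_colored_graph H col = prod_encode (encode_graph H, encode_map (verts H) col)"

definition encode_decomposition ::
  "nat ugraph \<Rightarrow> nat \<Rightarrow> (nat \<Rightarrow> nat set) \<Rightarrow> (nat \<Rightarrow> nat set) \<Rightarrow> nat" where
  "encode_decomposition T r \<beta> g = list_encode
     [encode_graph T, r,
      encode_map (verts T) (\<lambda>t. set_encode (\<beta> t)),
      encode_map (verts T) (\<lambda>t. set_encode (g t))]"

end

theory Submission
  imports Defs
begin

text \<open>
  A forest argument in the style of Gallai's theorem on disjoint paths gives, for every color \<open>i\<close>,
  a set \<open>S i\<close> of at most \<open>4 * c\<close> vertices that hits all paths between vertices of color \<open>i\<close> in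
  the graph where all other colors are cliques. The decomposition is built from the root: for a
  component \<open>K\<close> of what remains, with boundary \<open>N\<close>, take a bag \<open>X\<close> of a tree decomposition of the
  graph of colors that is a balanced separator for the colors of \<open>N\<close>. The new bag contains \<open>N\<close> and,
  within \<open>K\<close>, the colors in \<open>X\<close>, the sets \<open>S i\<close> with \<open>i\<close> in \<open>X\<close>, and, for distinct \<open>i\<close> and \<open>j\<close>
  in \<open>X\<close>, the only vertex of color \<open>i\<close> outside \<open>S i\<close> that can be reached from color \<open>j\<close> avoiding
  \<open>S i\<close>. All of these but the colors in \<open>X\<close> form the guard. A component of the rest with two
  neighbors outside the guard would connect them, so it has at most one; and as it sees at most one
  vertex of each color \<open>i\<close> in \<open>X\<close> outside \<open>S i\<close>, its boundary has at most half the size of \<open>N\<close> plus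
  \<open>O((c + w) w)\<close>. So boundaries and guards have size \<open>O((c + w) w)\<close> throughout.

  As the required decomposition exists and its properties can be checked by bounded quantification
  over the codes, unbounded search computes one.
\<close>

text \<open>Bags may contain large parts of color classes, so their sizes are unbounded; what has to
  stay bounded is the boundary handed down from node to node. Every step enlarges it by hitting sets
  and single vertices, and this would accumulate along a branch. Balancing the separator against the
  inherited boundary is the counterweight: halving plus a constant has a fixed point,
  \<open>max_adhesion\<close>.

  The hitting set \<open>S i\<close> says something only about connections that do without the
  clique on color \<open>i\<close>. Components of the rest provide such connections, because they
  contain no color of \<open>X\<close> at all.

  Nodes are numbered so that parents precede children. This form serves induction over a
  decomposition, appending nodes, and checking by bounded quantifiers, as connectivity of subtrees
  becomes a condition on pairs of nodes. The search tests the bounds on guards and colors, never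
  treewidth or flowers: the hypotheses guarantee that it stops.\<close>

section \<open>Paths and reachability inside a vertex set\<close>

definition adj :: "'a ugraph \<Rightarrow> 'a set \<Rightarrow> ('a \<times> 'a) set" where
  "adj G W = {(a, b). {a, b} \<in> edges G \<and> a \<in> W \<and> b \<in> W}"

lemma sym_adj: "sym (adj G W)"
  by (auto simp: adj_def sym_def insert_commute)

lemma adj_rtrancl_sym: "(a, b) \<in> (adj G W)\<^sup>* \<Longrightarrow> (b, a) \<in> (adj G W)\<^sup>*"
  using sym_rtrancl[OF sym_adj, of G W] by (meson symD)

lemma adj_rtrancl_mono:
  assumes "(a, b) \<in> (adj G W)\<^sup>*" "W \<subseteq> W'" "edges G \<subseteq> edges G'"
  shows "(a, b) \<in> (adj G' W')\<^sup>*"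
  using assms by (auto simp: adj_def elim!: rtrancl_mono[THEN subsetD, rotated])

lemma adj_rtrancl_in: "(a, b) \<in> (adj G W)\<^sup>* \<Longrightarrow> a \<in> W \<Longrightarrow> b \<in> W"
  by (induction rule: rtrancl_induct) (auto simp: adj_def)

lemma is_path_singleton: "v \<in> verts G \<Longrightarrow> is_path G [v]"
  by (simp add: is_path_def)

lemma is_path_append:
  assumes "is_path G p" "is_path G q" "set p \<inter> set q = {}" "{last p, hd q} \<in> edges G"
  shows "is_path G (p @ q)"
  using assms by (auto simp: is_path_def successively_append_iff)

lemma is_path_Cons:
  assumes "is_path G q" "v \<in> verts G" "v \<notin> set q" "{v, hd q} \<in> edges G"
  shows "is_path G (v # q)"
  using is_path_append[of G "[v]" q] assms by (simp add: is_path_singleton)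

lemma is_path_appendD1: "is_path G (p @ q) \<Longrightarrow> p \<noteq> [] \<Longrightarrow> is_path G p"
  by (auto simp: is_path_def successively_append_iff)

lemma is_path_appendD2: "is_path G (p @ q) \<Longrightarrow> q \<noteq> [] \<Longrightarrow> is_path G q"
  by (auto simp: is_path_def successively_append_iff)

lemma is_path_append_edge:
  "is_path G (p @ q) \<Longrightarrow> p \<noteq> [] \<Longrightarrow> q \<noteq> [] \<Longrightarrow> {last p, hd q} \<in> edges G"
  by (auto simp: is_path_def successively_append_iff)

lemma is_path_rev: "is_path G p \<Longrightarrow> is_path G (rev p)"
  by (auto simp: is_path_def successively_rev insert_commute)

lemma reachable_imp_path:
  assumes "(u, v) \<in> (adj G W)\<^sup>*" "u \<in> W" "W \<subseteq> verts G"
  shows "\<exists>p. is_path G p \<and> hd p = u \<and> last p = v \<and> set p \<subseteq> W"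
  using assms(1)
proof (induction rule: rtrancl_induct)
  case base
  have "is_path G [u]" using assms by (auto intro: is_path_singleton)
  with assms show ?case by (intro exI[of _ "[u]"]) auto
next
  case (step y z)
  then obtain p where p: "is_path G p" "hd p = u" "last p = y" "set p \<subseteq> W" by blast
  from step(2) have yz: "{y, z} \<in> edges G" "z \<in> W" by (auto simp: adj_def)
  show ?case
  proof (cases "z \<in> set p")
    \<comment> \<open>A walk that returns to \<open>z\<close> is cut back to the prefix ending at
      \<open>z\<close>, so the path stays simple.\<close>
    case True
    then obtain q r where "p = q @ z # r" by (meson split_list)
    with p have "is_path G (q @ [z])" using is_path_appendD1[of G "q @ [z]" r] by simp
    moreover have "hd (q @ [z]) = u" using \<open>p = _\<close> p by (cases q) auto
    ultimately show ?thesis using \<open>p = _\<close> p by (intro exI[of _ "q @ [z]"]) auto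
  next
    case False
    have "is_path G (p @ [z])" using False p yz assms(3)
      by (intro is_path_append) (auto intro: is_path_singleton)
    moreover have "p \<noteq> []" using p by (auto simp: is_path_def)
    ultimately show ?thesis using p yz by (intro exI[of _ "p @ [z]"]) auto
  qed
qed

lemma path_imp_reachable:
  assumes "is_path G p" "set p \<subseteq> W"
  shows "(hd p, last p) \<in> (adj G W)\<^sup>*"
  using assms
proof (induction p)
  case (Cons a p)
  show ?case
  proof (cases p)
    case (Cons b q)
    with Cons.prems have "is_path G p" "{a, b} \<in> edges G"
      by (auto simp: is_path_def)
    with Cons.IH Cons.prems have "(hd p, last p) \<in> (adj G W)\<^sup>*" by auto
    moreover have "(a, hd p) \<in> adj G W" using Cons.prems Cons \<open>{a, b} \<in> edges G\<close>
      by (auto simp: adj_def)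
    ultimately show ?thesis using Cons by auto
  qed auto
qed (auto simp: is_path_def)

lemma connected_graph_iff_reachable:
  "connected_graph G \<longleftrightarrow> (\<forall>u\<in>verts G. \<forall>v\<in>verts G. (u, v) \<in> (adj G (verts G))\<^sup>*)"
proof -
  have "(\<exists>p. is_path G p \<and> hd p = u \<and> last p = v) \<longleftrightarrow> (u, v) \<in> (adj G (verts G))\<^sup>*"
    if "u \<in> verts G" for u v
    using reachable_imp_path[of u v G "verts G"] path_imp_reachable[of G _ "verts G"] that
    by (auto simp: is_path_def)
  then show ?thesis unfolding connected_graph_def by blast
qed

section \<open>Hitting sets for paths between vertices of a fixed set\<close>

text \<open>This is a flower without prescribed size; the extra parameter \<open>V\<close> allows
  packings of disjoint trees to be united.\<close>

definition packing :: "'a ugraph \<Rightarrow> 'a set \<Rightarrow> 'a set \<Rightarrow> 'a list set \<Rightarrow> bool" where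
  "packing G A V P \<longleftrightarrow> finite P \<and>
     (\<forall>p\<in>P. is_path G p \<and> 2 \<le> length p \<and> hd p \<in> A \<and> last p \<in> A \<and> set p \<subseteq> V) \<and>
     (\<forall>p\<in>P. \<forall>q\<in>P. p \<noteq> q \<longrightarrow> set p \<inter> set q = {})"

lemma packingD:
  assumes "packing G A V P" "p \<in> P"
  shows "is_path G p" "set p \<subseteq> V"
  using assms by (auto simp: packing_def)

lemma packing_empty: "packing G A V {}"
  by (simp add: packing_def)

lemma packing_mono: "packing G A V P \<Longrightarrow> V \<subseteq> W \<Longrightarrow> packing G A W P"
  unfolding packing_def by blast

lemma packing_Un:
  assumes "packing G A V P" "packing G A W Q" "V \<inter> W = {}"
  shows "packing G A (V \<union> W) (P \<union> Q)" "card (P \<union> Q) = card P + card Q"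
proof -
  have *: "set p \<inter> set q = {}" "p \<noteq> []" if "p \<in> P" "q \<in> Q" for p q
    using packingD[OF assms(1) that(1)] packingD[OF assms(2) that(2)] assms(3)
    by (auto simp: is_path_def)
  then have "P \<inter> Q = {}" by fastforce
  then show "card (P \<union> Q) = card P + card Q"
    using assms unfolding packing_def by (intro card_Un_disjoint) auto
  show "packing G A (V \<union> W) (P \<union> Q)"
    using assms * unfolding packing_def by blast
qed

lemma packing_insert:
  assumes "packing G A V P" "is_path G p" "2 \<le> length p" "hd p \<in> A" "last p \<in> A"
    "set p \<subseteq> V" "\<forall>q\<in>P. set p \<inter> set q = {}"
  shows "packing G A V (insert p P)" "card (insert p P) = Suc (card P)"
proof -
  from assms have "p \<notin> P" by (auto simp: is_path_def)
  with assms show "card (insert p P) = Suc (card P)" by (simp add: packing_def)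
  show "packing G A V (insert p P)" using assms unfolding packing_def by blast
qed

text \<open>
  In \<open>atree G A v V n S\<close> the vertex \<open>v\<close> is the root of a binary tree in \<open>G\<close> with vertex set \<open>V\<close>
  and \<open>n\<close> leaves, which are its vertices in \<open>A\<close>; \<open>S\<close> consists of leaves and branching vertices.
\<close>

inductive atree :: "'a ugraph \<Rightarrow> 'a set \<Rightarrow> 'a \<Rightarrow> 'a set \<Rightarrow> nat \<Rightarrow> 'a set \<Rightarrow> bool" for G A where
  leaf: "v \<in> A \<Longrightarrow> v \<in> verts G \<Longrightarrow> atree G A v {v} 1 {v}"
| ext: "atree G A u V n S \<Longrightarrow> v \<in> verts G \<Longrightarrow> v \<notin> A \<Longrightarrow> v \<notin> V \<Longrightarrow> {v, u} \<in> edges G \<Longrightarrow>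
    atree G A v (insert v V) n S"
| join: "atree G A u V n S \<Longrightarrow> atree G A u' V' n' S' \<Longrightarrow> V \<inter> V' = {} \<Longrightarrow>
    v \<in> verts G \<Longrightarrow> v \<notin> A \<Longrightarrow> v \<notin> V \<union> V' \<Longrightarrow> {v, u} \<in> edges G \<Longrightarrow> {v, u'} \<in> edges G \<Longrightarrow>
    atree G A v (insert v (V \<union> V')) (n + n') (insert v (S \<union> S'))"

text \<open>A binary tree with \<open>n\<close> leaves has \<open>n - 1\<close> branching vertices,
  which bounds \<open>S\<close> by \<open>2 * n - 1\<close>.\<close>

lemma atree_props:
  assumes "atree G A v V n S"
  shows "v \<in> V \<and> V \<subseteq> verts G \<and> finite V \<and> S \<subseteq> V \<and> A \<inter> V \<subseteq> S \<and> 1 \<le> n \<and>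
    n \<le> card (A \<inter> V) \<and> card S + 1 \<le> 2 * n"
  using assms
proof (induction rule: atree.induct)
  case (join u V n S u' V' n' S' v)
  have "A \<inter> insert v (V \<union> V') = (A \<inter> V) \<union> (A \<inter> V')" using join by auto
  moreover have "card ((A \<inter> V) \<union> (A \<inter> V')) = card (A \<inter> V) + card (A \<inter> V')"
    using join by (intro card_Un_disjoint) auto
  moreover have "card (insert v (S \<union> S')) \<le> Suc (card S + card S')"
    by (metis card_Un_le card_insert_le_m1 diff_Suc_1 le_SucI not_less_eq_eq card_insert_le add.commute
        card_insert_if finite_insert Suc_le_mono card.infinite zero_le)
  ultimately show ?case using join by auto
qed auto

text \<open>Leaves are paired from the bottom up. An odd number of leaves leaves one over, and its
  path to the root is kept free. Two such paths from below a branching vertex merge there into a new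
  path of the packing.\<close>

lemma atree_packing:
  assumes "atree G A v V n S"
  shows "(even n \<longrightarrow> (\<exists>P. packing G A V P \<and> card P = n div 2)) \<and>
    (odd n \<longrightarrow> (\<exists>P p. packing G A V P \<and> card P = n div 2 \<and> is_path G p \<and> hd p = v \<and>
       last p \<in> A \<and> set p \<subseteq> V \<and> (\<forall>q\<in>P. set p \<inter> set q = {})))"
  using assms
proof (induction rule: atree.induct)
  case (leaf v)
  then show ?case
    by (auto intro!: exI[of _ "{}"] exI[of _ "[v]"] packing_empty is_path_singleton)
next
  case (ext u V n S v)
  show ?case
  proof (cases "even n")
    case True
    with ext show ?thesis by (metis packing_mono subset_insertI)
  next
    case False
    with ext obtain P p where P: "packing G A V P" "card P = n div 2" "is_path G p" "hd p = u"
      "last p \<in> A" "set p \<subseteq> V" "\<forall>q\<in>P. set p \<inter> set q = {}" by auto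
    have "p \<noteq> []" using P by (auto simp: is_path_def)
    moreover have "is_path G (v # p)" using P ext by (intro is_path_Cons) auto
    moreover have "\<forall>q\<in>P. v \<notin> set q" using P(1) ext unfolding packing_def by blast
    moreover have "packing G A (insert v V) P" using P(1) by (rule packing_mono) auto
    ultimately show ?thesis using P False
      by (intro conjI impI exI[of _ P] exI[of _ "v # p"]) auto
  qed
next
  case (join u V n S u' V' n' S' v)
  have mono: "packing G A (insert v (V \<union> V')) R" if "packing G A (V \<union> V') R" for R
    using that by (rule packing_mono) auto
  have vnot: "\<forall>q\<in>R. v \<notin> set q" if "packing G A (V \<union> V') R" for R
    using packingD(2)[OF that] join.hyps by (meson Un_iff subsetD)
  \<comment> \<open>Both orders of an odd and an even subtree are treated at once: the free path of
    the odd one is extended to \<open>v\<close>.\<close>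
  have one_odd: "\<exists>P p. packing G A (insert v (V \<union> V')) P \<and> card P = (n + n') div 2 \<and>
       is_path G p \<and> hd p = v \<and> last p \<in> A \<and> set p \<subseteq> insert v (V \<union> V') \<and>
       (\<forall>q\<in>P. set p \<inter> set q = {})"
    if odd: "packing G A V1 P" "card P = n1 div 2" "is_path G p" "hd p = u1"
      "last p \<in> A" "set p \<subseteq> V1" "\<forall>q\<in>P. set p \<inter> set q = {}" "odd n1"
    and even: "packing G A V2 Q" "card Q = n2 div 2" "even n2"
    and eq: "V1 \<inter> V2 = {}" "V \<union> V' = V1 \<union> V2" "{v, u1} \<in> edges G" "n + n' = n1 + n2"
    for V1 V2 n1 n2 P p u1 Q
  proof -
    note U = packing_Un[OF odd(1) even(1) eq(1)]
    have "is_path G (v # p)" using odd eq join by (intro is_path_Cons) auto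
    moreover have "p \<noteq> []" using odd by (auto simp: is_path_def)
    moreover have "\<forall>q\<in>Q. set p \<inter> set q = {}" using odd(6) packingD(2)[OF even(1)] eq(1) by blast
    moreover have "(n + n') div 2 = n1 div 2 + n2 div 2" using odd(8) even(3) eq(4) by (auto elim!: oddE evenE)
    ultimately show ?thesis using U odd even eq mono[of "P \<union> Q"] vnot[of "P \<union> Q"]
      by (intro exI[of _ "P \<union> Q"] exI[of _ "v # p"]) auto
  qed
  show ?case
  proof (cases "even n"; cases "even n'")
    assume e: "even n" "even n'"
    then obtain P Q where "packing G A V P" "card P = n div 2" "packing G A V' Q" "card Q = n' div 2"
      using join.IH by auto
    with packing_Un[of G A V P V' Q] join mono[of "P \<union> Q"] e show ?thesis
      by (intro conjI impI exI[of _ "P \<union> Q"]) auto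
  next
    assume e: "even n" "odd n'"
    with one_odd[of V' _ n' _ u' V _ n] join show ?thesis by (simp add: Un_commute Int_commute) blast
  next
    assume e: "odd n" "even n'"
    with one_odd[of V _ n _ u V' _ n'] join show ?thesis by simp blast
  next
    assume e: "odd n" "odd n'"
    with join.IH obtain P p Q q where P: "packing G A V P" "card P = n div 2" "is_path G p" "hd p = u"
      "last p \<in> A" "set p \<subseteq> V" "\<forall>q\<in>P. set p \<inter> set q = {}"
      and Q: "packing G A V' Q" "card Q = n' div 2" "is_path G q" "hd q = u'"
      "last q \<in> A" "set q \<subseteq> V'" "\<forall>r\<in>Q. set q \<inter> set r = {}" by (metis (no_types, lifting))
    note U = packing_Un[OF P(1) Q(1) join.hyps(3)]
    have ne: "p \<noteq> []" "q \<noteq> []" using P Q by (auto simp: is_path_def)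
    have "is_path G (v # q)" using Q join by (intro is_path_Cons) auto
    then have path: "is_path G (rev p @ v # q)" using P Q join ne
      by (intro is_path_append is_path_rev) (auto simp: last_rev insert_commute)
    have disj: "\<forall>r\<in>P \<union> Q. set (rev p @ v # q) \<inter> set r = {}"
    proof
      fix r assume r: "r \<in> P \<union> Q"
      then have "v \<notin> set r" using vnot[OF U(1)] by blast
      moreover from r have "set p \<inter> set r = {}" "set q \<inter> set r = {}"
        using P(6,7) Q(6,7) packingD(2)[OF P(1)] packingD(2)[OF Q(1)] join.hyps(3) by blast+
      ultimately show "set (rev p @ v # q) \<inter> set r = {}" by auto
    qed
    have ends: "hd (rev p @ v # q) \<in> A" "last (rev p @ v # q) \<in> A"
      using P Q ne by (auto simp: hd_rev)
    have "2 \<le> length (rev p @ v # q)" "set (rev p @ v # q) \<subseteq> insert v (V \<union> V')"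
      using ne P Q by (cases p, auto)
    note I = packing_insert[OF mono[OF U(1)] path this(1) ends this(2) disj]
    have "card (insert (rev p @ v # q) (P \<union> Q)) = (n + n') div 2"
      unfolding I U P Q using e by (auto elim!: oddE)
    with I e show ?thesis by (metis even_add)
  qed
qed

text \<open>A vertex outside \<open>S\<close> has exactly one child, so a second branch can grow
  there and the tree stays binary. The attached tree has a single leaf, hence is a path.\<close>

lemma atree_attach:
  assumes "atree G A v V n S" "x \<in> V" "x \<notin> S" "{x, y} \<in> edges G" "atree G A y Q 1 R" "Q \<inter> V = {}"
  shows "\<exists>S'. atree G A v (V \<union> Q) (Suc n) S'"
  using assms
proof (induction rule: atree.induct)
  case (ext u V n S v)
  show ?case
  proof (cases "x = v")
    case True
    with ext have "atree G A v (insert v (V \<union> Q)) (n + 1) (insert v (S \<union> R))"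
      by (intro join[of _ _ u _ _ _ y]) auto
    then show ?thesis by auto
  next
    case False
    with ext obtain S' where "atree G A u (V \<union> Q) (Suc n) S'" by auto
    with ext have "atree G A v (insert v (V \<union> Q)) (Suc n) S'" by (intro atree.ext) auto
    then show ?thesis by auto
  qed
next
  case (join u V n S u' V' n' S' v)
  then consider "x \<in> V" "x \<notin> S" | "x \<in> V'" "x \<notin> S'" by auto
  then show ?case
  proof cases
    case 1
    with join obtain S'' where "atree G A u (V \<union> Q) (Suc n) S''" by auto
    with join have "atree G A v (insert v ((V \<union> Q) \<union> V')) (Suc n + n') (insert v (S'' \<union> S'))"
      by (intro atree.join[of _ _ u _ _ _ u']) auto
    then show ?thesis by (auto simp: Un_ac)
  next
    case 2
    with join obtain S'' where "atree G A u' (V' \<union> Q) (Suc n') S''" by auto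
    with join have "atree G A v (insert v (V \<union> (V' \<union> Q))) (n + Suc n') (insert v (S \<union> S''))"
      by (intro atree.join[of _ _ u _ _ _ u']) auto
    then show ?thesis by (auto simp: Un_ac)
  qed
qed auto

lemma path_atree:
  assumes "is_path G q" "last q \<in> A" "set (butlast q) \<inter> A = {}"
  shows "atree G A (hd q) (set q) 1 {last q}"
  using assms
proof (induction q)
  case (Cons a q)
  show ?case
  proof (cases "q = []")
    case True
    with Cons show ?thesis using leaf[of a A G] by (auto simp: is_path_def)
  next
    case False
    then have q: "is_path G q" "{a, hd q} \<in> edges G" "a \<in> verts G" "a \<notin> set q"
      using Cons.prems(1) is_path_appendD2[of G "[a]" q] is_path_append_edge[of G "[a]" q]
      by (auto simp: is_path_def)
    with Cons False show ?thesis by (auto intro!: ext[of _ _ "hd q"])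
  qed
qed (simp add: is_path_def)

section \<open>Binary forests and the hitting set\<close>

text \<open>Each component is an \<open>atree\<close> below one additional leaf \<open>a\<close>, so
  that it has at least two leaves. A lone vertex of \<open>A\<close> would count in \<open>S\<close>
  without contributing a path.\<close>

inductive aforest :: "'a ugraph \<Rightarrow> 'a set \<Rightarrow> 'a set \<Rightarrow> nat \<Rightarrow> 'a set \<Rightarrow> bool" for G A where
  empty: "aforest G A {} 0 {}"
| add: "aforest G A W m R \<Longrightarrow> atree G A u V n S \<Longrightarrow> a \<in> A \<Longrightarrow> a \<in> verts G \<Longrightarrow>
    {a, u} \<in> edges G \<Longrightarrow> a \<notin> V \<Longrightarrow> W \<inter> insert a V = {} \<Longrightarrow>
    aforest G A (W \<union> insert a V) (m + Suc n) (R \<union> insert a S)"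

lemma aforest_props:
  assumes "aforest G A V m S"
  shows "V \<subseteq> verts G \<and> finite V \<and> S \<subseteq> V \<and> A \<inter> V \<subseteq> S \<and> m \<le> card (A \<inter> V)"
  using assms
proof (induction rule: aforest.induct)
  case (add W m R u V n S a)
  note t = atree_props[OF add.hyps(2)]
  have "A \<inter> (W \<union> insert a V) = (A \<inter> W) \<union> insert a (A \<inter> V)" using add by auto
  moreover have "card ((A \<inter> W) \<union> insert a (A \<inter> V)) = card (A \<inter> W) + card (insert a (A \<inter> V))"
    using add t by (intro card_Un_disjoint) auto
  ultimately show ?case using add t by auto
qed auto

lemma aforest_packing:
  assumes "aforest G A V m S"
  shows "\<exists>P. packing G A V P \<and> card S \<le> 4 * card P"
  using assms
proof (induction rule: aforest.induct)
  case (add W m R u V n S a)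
  then obtain Q where Q: "packing G A W Q" "card R \<le> 4 * card Q" by auto
  note t = atree_props[OF add.hyps(2)]
  \<comment> \<open>Here the constant 4 arises: with \<open>n\<close> leaves below \<open>a\<close>,
    the component puts at most \<open>2 * n\<close> vertices into the hitting set and contributes at
    least \<open>n / 2\<close> paths, since for odd \<open>n\<close> the path left over is completed
    by \<open>a\<close>.\<close>
  obtain P where P: "packing G A (insert a V) P" "n \<le> 2 * card P"
  proof (cases "even n")
    case True
    with atree_packing[OF add.hyps(2)] obtain P where "packing G A V P" "card P = n div 2" by auto
    with True that[of P] show ?thesis
      by (metis packing_mono subset_insertI even_two_times_div_two order_refl)
  next
    case False
    with atree_packing[OF add.hyps(2)] obtain P p where P: "packing G A V P" "card P = n div 2"
      "is_path G p" "hd p = u" "last p \<in> A" "set p \<subseteq> V" "\<forall>q\<in>P. set p \<inter> set q = {}" by auto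
    have "p \<noteq> []" using P by (auto simp: is_path_def)
    moreover have "is_path G (a # p)" using P add by (intro is_path_Cons) auto
    moreover have "\<forall>q\<in>P. a \<notin> set q" using P(1) add unfolding packing_def by blast
    moreover have "packing G A (insert a V) P" using P(1) by (rule packing_mono) auto
    ultimately have "packing G A (insert a V) (insert (a # p) P)"
      "card (insert (a # p) P) = Suc (card P)"
      using packing_insert[of G A "insert a V" P "a # p"] P add by (cases p; auto)+
    with that P show ?thesis by simp
  qed
  note U = packing_Un[OF Q(1) P(1) add.hyps(7)]
  have "card (R \<union> insert a S) \<le> card R + card (insert a S)" by (rule card_Un_le)
  also have "card (insert a S) \<le> Suc (card S)" by (simp add: card_insert_le_m1 card_insert_if)
  finally show ?case using U t P(2) Q(2) by (intro exI[of _ "Q \<union> P"]) auto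
qed (auto intro: exI[of _ "{}"] packing_empty)

lemma aforest_attach:
  assumes "aforest G A V m S" "x \<in> V" "x \<notin> S" "{x, y} \<in> edges G" "atree G A y Q 1 R" "Q \<inter> V = {}"
  shows "\<exists>S'. aforest G A (V \<union> Q) (Suc m) S'"
  using assms
proof (induction rule: aforest.induct)
  case (add W m T u V n S a)
  then consider "x \<in> W" "x \<notin> T" | "x \<in> V" "x \<notin> S" by auto
  then show ?case
  proof cases
    case 1
    with add obtain S'' where "aforest G A (W \<union> Q) (Suc m) S''" by auto
    with add have "aforest G A ((W \<union> Q) \<union> insert a V) (Suc m + Suc n) (S'' \<union> insert a S)"
      by (intro aforest.add[of _ _ _ _ _ u]) auto
    then show ?thesis by (auto simp: Un_ac)
  next
    case 2
    with add atree_attach[of G A u V n S x y Q R] obtain S'' where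
      "atree G A u (V \<union> Q) (Suc n) S''" by auto
    with add have "aforest G A (W \<union> insert a (V \<union> Q)) (m + Suc (Suc n)) (T \<union> insert a S'')"
      by (intro aforest.add[of _ _ _ _ _ u]) auto
    then show ?thesis by (auto simp: Un_ac)
  qed
qed auto

text \<open>
  The leaves and branching vertices of a binary forest with as many leaves as possible hit every
  path between two vertices of \<open>A\<close>: a path avoiding them either contains a new component or can be
  attached to the forest. Half of the leaves of each tree can be joined by disjoint paths.
\<close>

lemma ex_hitting_set:
  assumes "finite (verts G)" "A \<subseteq> verts G"
    and no: "\<nexists>P. packing G A (verts G) P \<and> card P = c"
  shows "\<exists>S. S \<subseteq> verts G \<and> card S \<le> 4 * c \<and>
    (\<forall>a\<in>A - S. \<forall>b\<in>A - S. a \<noteq> b \<longrightarrow> (a, b) \<notin> (adj G (verts G - S))\<^sup>*)"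
proof -
  \<comment> \<open>Leaves are distinct vertices of \<open>A\<close>, so their number is bounded and
    a forest with most leaves exists.\<close>
  let ?Q = "\<lambda>m. \<exists>V S. aforest G A V m S"
  have "?Q 0" using empty by blast
  moreover have "\<forall>m. ?Q m \<longrightarrow> m \<le> card (verts G)"
    using aforest_props assms(1) by (metis card_mono inf.coboundedI2 order_trans)
  ultimately obtain m where m: "?Q m" "\<forall>k. ?Q k \<longrightarrow> k \<le> m"
    using GreatestI_nat[of ?Q 0 "card (verts G)"] Greatest_le_nat[of ?Q _ "card (verts G)"] by auto
  then obtain V S where F: "aforest G A V m S" by blast
  note props = aforest_props[OF F]
  obtain P where P: "packing G A V P" "card S \<le> 4 * card P" using aforest_packing[OF F] by blast
  have "card P < c"
  proof (rule ccontr)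
    assume "\<not> card P < c"
    then obtain P' where "P' \<subseteq> P" "card P' = c" by (meson not_less obtain_subset_with_card_n)
    moreover from this P(1) props have "packing G A (verts G) P'"
      unfolding packing_def by (meson finite_subset subset_eq)
    ultimately show False using no by blast
  qed
  moreover have "(a, b) \<notin> (adj G (verts G - S))\<^sup>*" if ab: "a \<in> A - S" "b \<in> A - S" "a \<noteq> b" for a b
  proof
    assume "(a, b) \<in> (adj G (verts G - S))\<^sup>*"
    then obtain p where p: "is_path G p" "hd p = a" "last p = b" "set p \<subseteq> verts G - S"
      using reachable_imp_path[of a b G "verts G - S"] ab assms(2) by auto
    then obtain q where q: "p = a # q" by (cases p) (auto simp: is_path_def)
    with p ab have "q \<noteq> []" by auto
    \<comment> \<open>The segment strictly between \<open>a\<close> and the first such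
      \<open>y\<close> meets neither \<open>A\<close> nor the forest. As \<open>y\<close> is not in
      \<open>S\<close>, it is either a vertex of \<open>A\<close> outside the forest, giving a new
      component, or a forest vertex where a branch to \<open>a\<close> can be attached.\<close>
    have "\<exists>y\<in>set q. y \<in> A \<union> V" using p q ab \<open>q \<noteq> []\<close>
      by (intro bexI[of _ "last q"]) auto
    from split_list_first_prop[OF this] obtain q1 y q2 where
      y: "q = q1 @ y # q2" "y \<in> A \<union> V" "\<forall>z\<in>set q1. z \<notin> A \<union> V" by blast
    have path: "is_path G ((a # q1 @ [y]) @ q2)" using p q y by simp
    then have path1: "is_path G (a # q1 @ [y])" by (rule is_path_appendD1) simp
    have aV: "a \<notin> V" using ab props by auto
    have yS: "y \<notin> S" using p q y by auto
    have dist: "a \<noteq> y" "a \<notin> set q1" "y \<notin> set q1" using path1 by (auto simp: is_path_def)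
    have aG: "a \<in> verts G" using ab assms(2) by auto
    show False
    proof (cases "y \<in> A")
      case True
      have path2: "is_path G (q1 @ [y])"
        using path1 is_path_appendD2[of G "[a]" "q1 @ [y]"] by simp
      have e: "{a, hd (q1 @ [y])} \<in> edges G"
        using is_path_append_edge[of G "[a]" "q1 @ [y]"] path1 by simp
      have t: "atree G A (hd (q1 @ [y])) (set (q1 @ [y])) 1 {y}"
        using path_atree[OF path2, of A] True y by auto
      have "y \<notin> V" using True yS props by auto
      then have "?Q (m + Suc 1)"
        using aforest.add[OF F t, of a] e aG ab aV y(3) dist by fastforce
      with m show False by fastforce
    next
      case False
      have path2: "is_path G (rev (a # q1))" using path1 is_path_appendD1[of G "a # q1" "[y]"]
        by (intro is_path_rev) auto
      have e: "{y, hd (rev (a # q1))} \<in> edges G"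
        using is_path_append_edge[of G "a # q1" "[y]"] path1 by (auto simp: insert_commute hd_append hd_rev)
      have t: "atree G A (hd (rev (a # q1))) (set (rev (a # q1))) 1 {a}"
        using path_atree[OF path2, of A] ab y by auto
      have "?Q (Suc m)"
        using aforest_attach[OF F _ yS e t] False y aV by fastforce
      with m show False by fastforce
    qed
  qed
  ultimately show ?thesis using P props by (intro exI[of _ S]) auto
qed

section \<open>Tree decompositions with ordered nodes\<close>

text \<open>The last clause is a local form of the connectivity of subtrees: a vertex that occurs at
  \<open>t\<close> and at any earlier node must be passed on by the parent of \<open>t\<close>. It
  only looks backwards, so appending a node leaves the earlier conditions intact.\<close>

definition ordered_decomposition ::
  "'a ugraph \<Rightarrow> nat \<Rightarrow> (nat \<Rightarrow> nat) \<Rightarrow> (nat \<Rightarrow> 'a set) \<Rightarrow> bool" where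
  "ordered_decomposition G n p B \<longleftrightarrow> 0 < n \<and> (\<forall>t<n. 0 < t \<longrightarrow> p t < t) \<and>
     (\<forall>t<n. B t \<subseteq> verts G) \<and>
     (\<forall>v\<in>verts G. \<exists>t<n. v \<in> B t) \<and>
     (\<forall>e\<in>edges G. \<exists>t<n. e \<subseteq> B t) \<and>
     (\<forall>t<n. \<forall>s<t. B t \<inter> B s \<subseteq> B (p t))"

definition ordered_tree :: "nat \<Rightarrow> (nat \<Rightarrow> nat) \<Rightarrow> nat ugraph" where
  "ordered_tree n p = \<lparr>verts = {..<n}, edges = {{t, p t} | t. 0 < t \<and> t < n}\<rparr>"

lemma ordered_tree_edge_iff:
  assumes "\<And>t. 0 < t \<Longrightarrow> t < n \<Longrightarrow> p t < t" "s < t" "t < n"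
  shows "{s, t} \<in> edges (ordered_tree n p) \<longleftrightarrow> s = p t"
proof
  assume "{s, t} \<in> edges (ordered_tree n p)"
  then obtain u where "{s, t} = {u, p u}" "0 < u" "u < n" by (auto simp: ordered_tree_def)
  with assms(1)[of u] assms(2) show "s = p t" by (auto simp: doubleton_eq_iff)
next
  assume "s = p t"
  with assms(2,3) show "{s, t} \<in> edges (ordered_tree n p)"
    by (auto simp: ordered_tree_def insert_commute)
qed

lemma ordered_tree_edge: "0 < t \<Longrightarrow> t < n \<Longrightarrow> {p t, t} \<in> edges (ordered_tree n p)"
  by (auto simp: ordered_tree_def insert_commute)

lemma is_tree_ordered_tree:
  assumes p: "\<And>t. 0 < t \<Longrightarrow> t < n \<Longrightarrow> p t < t" and "0 < n"
  shows "is_tree (ordered_tree n p)"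
proof -
  let ?T = "ordered_tree n p"
  have "(t, 0) \<in> (adj ?T {..<n})\<^sup>*" if "t < n" for t
    using that
  proof (induction t rule: less_induct)
    case (less t)
    show ?case
    proof (cases "t = 0")
      case False
      with less p[of t] have "(t, p t) \<in> adj ?T {..<n}"
        by (auto simp: adj_def ordered_tree_def)
      moreover have "(p t, 0) \<in> (adj ?T {..<n})\<^sup>*" using less p[of t] False by auto
      ultimately show ?thesis by (rule converse_rtrancl_into_rtrancl)
    qed auto
  qed
  then have "(s, t) \<in> (adj ?T {..<n})\<^sup>*" if "s < n" "t < n" for s t
    using that by (meson adj_rtrancl_sym rtrancl_trans)
  then have conn: "connected_graph ?T"
    by (auto simp: connected_graph_iff_reachable ordered_tree_def)
  have "acyclic_graph ?T"
    unfolding acyclic_graph_def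
  proof
    assume "\<exists>q. is_path ?T q \<and> 3 \<le> length q \<and> {last q, hd q} \<in> edges ?T"
    then obtain q where q: "is_path ?T q" "3 \<le> length q" "{last q, hd q} \<in> edges ?T" by blast
    define m where "m = Max (set q)"
    have qn: "set q \<subseteq> {..<n}" using q by (auto simp: is_path_def ordered_tree_def)
    have "m \<in> set q" "\<forall>x\<in>set q. x \<le> m"
      using q by (auto simp: m_def is_path_def)
    then obtain q1 q2 where m: "q = q1 @ m # q2" by (meson split_list)
    text \<open>The largest vertex of a cycle would have two distinct parents.\<close>
    define a where "a = (if q1 = [] then last q else last q1)"
    define b where "b = (if q2 = [] then hd q else hd q2)"
    have dist: "distinct (q1 @ m # q2)" using q m by (auto simp: is_path_def)
    have "a \<in> set q - {m}" "b \<in> set q - {m}"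
      using dist q(2) unfolding m a_def b_def by (cases q1; cases q2; auto)+
    moreover have "a \<noteq> b"
    proof -
      have "last xs \<noteq> hd xs" if "distinct xs" "2 \<le> length xs" for xs :: "nat list"
        using that by (cases xs) auto
      moreover have "last q1 \<noteq> hd q2" if "q1 \<noteq> []" "q2 \<noteq> []"
      proof
        assume "last q1 = hd q2"
        with that have "hd q2 \<in> set q1 \<inter> set q2" using last_in_set[of q1] hd_in_set[of q2] by auto
        with dist show False by auto
      qed
      ultimately show ?thesis using dist q(2) unfolding m a_def b_def
        by (cases "q1 = []"; cases "q2 = []") auto
    qed
    moreover have "{a, m} \<in> edges ?T" "{b, m} \<in> edges ?T"
      using q(1,3) is_path_append_edge[of ?T q1 "m # q2"] is_path_append_edge[of ?T "q1 @ [m]" q2]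
      unfolding m a_def b_def by (auto simp: insert_commute)
    moreover have "x < m" if "x \<in> set q - {m}" for x
      using that \<open>\<forall>x\<in>set q. x \<le> m\<close> by (simp add: nat_less_le)
    moreover have "m < n" using \<open>m \<in> set q\<close> qn by auto
    ultimately have "a = p m" "b = p m"
      using ordered_tree_edge_iff[OF p, of n a m] ordered_tree_edge_iff[OF p, of n b m] by auto
    with \<open>a \<noteq> b\<close> show False by simp
  qed
  moreover have "simple_graph ?T"
    unfolding simple_graph_def
  proof (intro conjI ballI)
    fix e assume "e \<in> edges ?T"
    then obtain t where t: "e = {t, p t}" "0 < t" "t < n" by (auto simp: ordered_tree_def)
    with p[of t] show "e \<subseteq> verts ?T" "card e = 2" by (auto simp: ordered_tree_def)
  qed (simp add: ordered_tree_def)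
  ultimately show ?thesis using conn \<open>0 < n\<close> by (auto simp: is_tree_def ordered_tree_def)
qed

text \<open>Since \<open>parent\<close> is a definite description, a path from the root through
  \<open>p t\<close> has to be exhibited and its last but one vertex shown to be unique.\<close>

lemma parent_ordered_tree:
  assumes p: "\<And>t. 0 < t \<Longrightarrow> t < n \<Longrightarrow> p t < t" and t: "0 < t" "t < n"
  shows "parent (ordered_tree n p) 0 t = p t"
proof -
  let ?T = "ordered_tree n p"
  have "\<exists>q. is_path ?T (q @ [t]) \<and> hd (q @ [t]) = 0 \<and> set q \<subseteq> {..<t}" if "t < n" for t
    using that
  proof (induction t rule: less_induct)
    case (less t)
    show ?case
    proof (cases "t = 0")
      case True
      with less show ?thesis
        by (intro exI[of _ "[]"]) (auto simp: ordered_tree_def intro: is_path_singleton)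
    next
      case False
      with less p[of t] obtain q where q: "is_path ?T (q @ [p t])" "hd (q @ [p t]) = 0"
        "set q \<subseteq> {..<p t}" by force
      have "is_path ?T ((q @ [p t]) @ [t])"
        using q less.prems p[of t] False ordered_tree_edge[of t n p]
        by (intro is_path_append[OF q(1)] is_path_singleton) (auto simp: ordered_tree_def)
      with q p[of t] False less show ?thesis
        by (intro exI[of _ "q @ [p t]"]) (auto simp: hd_append)
    qed
  qed
  from this[of "p t"] p[OF t] t obtain q where q: "is_path ?T (q @ [p t])" "hd (q @ [p t]) = 0"
    "set q \<subseteq> {..<p t}" by auto
  have "is_path ?T ((q @ [p t]) @ [t])"
    using q p[OF t] t ordered_tree_edge[of t n p]
    by (intro is_path_append[OF q(1)] is_path_singleton) (auto simp: ordered_tree_def)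
  then have ex: "\<exists>q. is_path ?T (q @ [p t, t]) \<and> hd (q @ [p t, t]) = 0"
    using q by (intro exI[of _ q]) (auto simp: hd_append)
  text \<open>A path from the root never goes back to a parent, hence it goes upwards in the order.\<close>
  have up: "s = p u" if "is_path ?T (q @ [s, u])" "hd (q @ [s, u]) = 0" for q s u
    using that
  proof (induction q arbitrary: s u rule: rev_induct)
    case Nil
    then have "{s, u} \<in> edges ?T" "s \<noteq> u" "s = 0" "u < n"
      by (auto simp: is_path_def ordered_tree_def)
    with p ordered_tree_edge_iff[OF p, of n s u] show ?case by auto
  next
    case (snoc r q)
    have path: "is_path ?T (q @ [r, s])"
      using snoc.prems is_path_appendD1[of ?T "q @ [r, s]" "[u]"] by simp
    then have r: "r = p s" using snoc by (intro snoc.IH) (auto simp: hd_append split: if_splits)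
    have e: "{s, u} \<in> edges ?T" "s < n" "u < n" "u \<noteq> r" "u \<noteq> s"
      using snoc.prems(1) is_path_append_edge[of ?T "q @ [r, s]" "[u]"]
      by (auto simp: is_path_def ordered_tree_def)
    then show ?case using r ordered_tree_edge_iff[OF p, of n s u] ordered_tree_edge_iff[OF p, of n u s]
      by (cases "s < u") (auto simp: insert_commute)
  qed
  show ?thesis unfolding parent_def using ex up by (intro the_equality) blast+
qed

text \<open>Of two distinct nodes whose bags contain \<open>v\<close>, the later one can be replaced
  by its parent, whose bag contains \<open>v\<close> too; repeated, this makes the nodes meet. The
  induction is on their sum because a replacement may reverse their order.\<close>

lemma ordered_tree_decomposition:
  assumes "ordered_decomposition G n p B"
  shows "tree_decomposition G (ordered_tree n p) B"
proof -
  have p: "\<And>t. 0 < t \<Longrightarrow> t < n \<Longrightarrow> p t < t" and n: "0 < n"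
    and top: "\<And>s t. t < n \<Longrightarrow> s < t \<Longrightarrow> B t \<inter> B s \<subseteq> B (p t)"
    using assms by (auto simp: ordered_decomposition_def)
  let ?T = "ordered_tree n p"
  have "connected_graph (induced ?T {t \<in> verts ?T. v \<in> B t})" for v
  proof -
    let ?W = "{t \<in> verts ?T. v \<in> B t}" and ?I = "induced ?T {t \<in> verts ?T. v \<in> B t}"
    have *: "(t, s) \<in> (adj ?I ?W)\<^sup>*" if "t < n" "s \<le> t" "v \<in> B t" "v \<in> B s" for s t
      using that
    proof (induction "s + t" arbitrary: s t rule: less_induct)
      case less
      show ?case
      proof (cases "s = t")
        case False
        with less have st: "s < t" by auto
        with less.prems top[of t s] p[of t] have pt: "v \<in> B (p t)" "p t < t" by auto
        have "(t, p t) \<in> adj ?I ?W"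
          using less pt st by (auto simp: adj_def induced_def ordered_tree_def)
        moreover have "(p t, s) \<in> (adj ?I ?W)\<^sup>*"
          using less.hyps[of s "p t"] less.hyps[of "p t" s] adj_rtrancl_sym less.prems pt st
          by (cases "s \<le> p t") (auto intro: adj_rtrancl_sym)
        ultimately show ?thesis by (rule converse_rtrancl_into_rtrancl)
      qed auto
    qed
    have "(t, s) \<in> (adj ?I ?W)\<^sup>*" if "t < n" "s < n" "v \<in> B t" "v \<in> B s" for s t
      using *[of t s] *[of s t] that by (cases "s \<le> t") (auto intro: adj_rtrancl_sym)
    then show ?thesis
      by (auto simp: connected_graph_iff_reachable induced_def ordered_tree_def)
  qed
  moreover have "verts ?T = {..<n}" by (simp add: ordered_tree_def)
  moreover have "\<exists>t\<in>{..<n}. e \<subseteq> B t" if "e \<in> edges G" for e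
    using assms that by (auto simp: ordered_decomposition_def Bex_def)
  ultimately show ?thesis using is_tree_ordered_tree[OF p n] assms
    by (auto simp: tree_decomposition_def ordered_decomposition_def)
qed

section \<open>Numbering the nodes of a given tree decomposition\<close>

lemma reachable_leaves_set:
  "(a, b) \<in> R\<^sup>* \<Longrightarrow> a \<in> W \<Longrightarrow> b \<notin> W \<Longrightarrow> \<exists>x y. (x, y) \<in> R \<and> x \<in> W \<and> y \<notin> W"
  by (induction rule: rtrancl_induct) auto

text \<open>This is graph search: as long as a node is missing, connectivity yields an edge leaving
  the enumerated set, and its inner end becomes the parent of the new node.\<close>

lemma ex_search_order:
  assumes T: "connected_graph T" "finite (verts T)" "verts T \<noteq> {}"
    and k: "1 \<le> k" "k \<le> card (verts T)"
  shows "\<exists>f p. inj_on f {..<k} \<and> f ` {..<k} \<subseteq> verts T \<and>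
    (\<forall>t<k. 0 < t \<longrightarrow> p t < t \<and> {f t, f (p t)} \<in> edges T)"
  using k
proof (induction k rule: nat_induct_at_least)
  case base
  from T obtain r where "r \<in> verts T" by blast
  then show ?case by (intro exI[of _ "\<lambda>_. r"]) (auto simp: inj_on_def)
next
  case (Suc k)
  then obtain f and p :: "nat \<Rightarrow> nat" where f: "inj_on f {..<k}" "f ` {..<k} \<subseteq> verts T"
    "\<forall>t<k. 0 < t \<longrightarrow> p t < t \<and> {f t, f (p t)} \<in> edges T" by auto
  have "card (f ` {..<k}) < card (verts T)" using f Suc by (simp add: card_image)
  with f obtain v where v: "v \<in> verts T" "v \<notin> f ` {..<k}" by (metis less_irrefl subsetI subset_antisym)
  have "f 0 \<in> f ` {..<k}" using Suc by auto
  with v f T(1) obtain x y where "(x, y) \<in> adj T (verts T)" "x \<in> f ` {..<k}" "y \<notin> f ` {..<k}"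
    using reachable_leaves_set[of "f 0" v "adj T (verts T)" "f ` {..<k}"]
    unfolding connected_graph_iff_reachable by blast
  then obtain j where j: "j < k" "{f j, y} \<in> edges T" "y \<in> verts T" "y \<notin> f ` {..<k}"
    by (auto simp: adj_def)
  have img: "f(k := y) ` {..<Suc k} = insert y (f ` {..<k})" by (auto simp: lessThan_Suc)
  have "inj_on (f(k := y)) {..<Suc k}"
    using f(1) j(4) by (auto simp: lessThan_Suc inj_on_def)
  moreover have "\<forall>t<Suc k. 0 < t \<longrightarrow> (p(k := j)) t < t \<and>
      {(f(k := y)) t, (f(k := y)) ((p(k := j)) t)} \<in> edges T"
    using f(3) j by (auto simp: less_Suc_eq insert_commute)
  ultimately show ?case using img j(3) f(2) by (metis insert_subset)
qed

text \<open>If the parent of \<open>f t\<close> missed a vertex \<open>v\<close> shared with an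
  earlier node, the subtree of \<open>v\<close> would lead from \<open>f t\<close> to an earlier
  node while avoiding \<open>f (p t)\<close>. Continuing among earlier nodes to
  \<open>f (p t)\<close> would close a cycle.\<close>

lemma ex_ordered_decomposition:
  assumes "tree_decomposition G T \<beta>"
  shows "\<exists>n p B. ordered_decomposition G n p B \<and> (\<forall>t<n. \<exists>s\<in>verts T. B t = \<beta> s)"
proof -
  let ?n = "card (verts T)"
  have T: "connected_graph T" "finite (verts T)" "verts T \<noteq> {}" "acyclic_graph T" and td:
    "\<forall>t\<in>verts T. \<beta> t \<subseteq> verts G" "\<forall>v\<in>verts G. \<exists>t\<in>verts T. v \<in> \<beta> t"
    "\<forall>e\<in>edges G. \<exists>t\<in>verts T. e \<subseteq> \<beta> t"
    "\<forall>v\<in>verts G. connected_graph (induced T {t \<in> verts T. v \<in> \<beta> t})"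
    using assms by (auto simp: tree_decomposition_def is_tree_def simple_graph_def)
  have n: "0 < ?n" using T by (simp add: card_gt_0_iff)
  then have "1 \<le> ?n" by simp
  from ex_search_order[OF T(1-3) this order_refl] obtain f p where
    f: "inj_on f {..<?n}" "f ` {..<?n} \<subseteq> verts T" and
    "\<forall>t<?n. 0 < t \<longrightarrow> p t < t \<and> {f t, f (p t)} \<in> edges T" by blast
  then have f3: "p t < t" "{f t, f (p t)} \<in> edges T" if "t < ?n" "0 < t" for t
    using that by blast+
  have onto: "f ` {..<?n} = verts T" using f T by (intro card_subset_eq) (auto simp: card_image)
  \<comment> \<open>Initial segments of the order are connected, as every node reaches node 0
    through its ancestors; this later closes the cycle.\<close>
  have conn: "(f s, f t) \<in> (adj T (f ` {..<k}))\<^sup>*" if "s < k" "t < k" "k \<le> ?n" for s t k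
  proof -
    have "(f t, f 0) \<in> (adj T (f ` {..<k}))\<^sup>*" if "t < k" for t
      using that
    proof (induction t rule: less_induct)
      case (less t)
      show ?case
      proof (cases "t = 0")
        case False
        with less \<open>k \<le> ?n\<close> f3[of t] have "(f t, f (p t)) \<in> adj T (f ` {..<k})"
          by (auto simp: adj_def)
        moreover have "(f (p t), f 0) \<in> (adj T (f ` {..<k}))\<^sup>*"
          using less \<open>k \<le> ?n\<close> f3[of t] False by auto
        ultimately show ?thesis by (rule converse_rtrancl_into_rtrancl)
      qed auto
    qed
    with that show ?thesis by (meson adj_rtrancl_sym rtrancl_trans)
  qed
  have top: "v \<in> \<beta> (f (p t))" if t: "t < ?n" "s < t" and v: "v \<in> \<beta> (f t)" "v \<in> \<beta> (f s)" for s t v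
  proof (rule ccontr)
    assume no: "v \<notin> \<beta> (f (p t))"
    let ?W = "{t \<in> verts T. v \<in> \<beta> t}"
    have ts: "f t \<in> verts T" "f s \<in> verts T" "f t \<noteq> f s"
      using t f(2) inj_onD[OF f(1), of t s] by auto
    have "v \<in> verts G" using v td(1) ts by blast
    with td(4) ts v have "(f t, f s) \<in> (adj (induced T ?W) ?W)\<^sup>*"
      by (simp add: connected_graph_iff_reachable induced_def)
    then have "(f t, f s) \<in> (adj T ?W)\<^sup>*"
      by (rule adj_rtrancl_mono) (auto simp: induced_def)
    then obtain q where q: "is_path T q" "hd q = f t" "last q = f s" "set q \<subseteq> ?W"
      using reachable_imp_path[of "f t" "f s" T ?W] ts v by auto
    then obtain q' where q': "q = f t # q'" by (cases q) (auto simp: is_path_def)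
    with q ts have "q' \<noteq> []" by auto
    with q q' t last_in_set[of q'] have "\<exists>y\<in>set q'. y \<in> f ` {..<t}"
      by (intro bexI[of _ "last q'"]) auto
    from split_list_first_prop[OF this] obtain q1 y q2 where
      y: "q' = q1 @ y # q2" "y \<in> f ` {..<t}" "\<forall>z\<in>set q1. z \<notin> f ` {..<t}" by blast
    have pt: "p t < t" "{f t, f (p t)} \<in> edges T" using f3[of t] t by auto
    from y(2) obtain j where j: "j < t" "y = f j" by auto
    with conn[of j t "p t"] pt t have "(y, f (p t)) \<in> (adj T (f ` {..<t}))\<^sup>*" by auto
    then obtain r where r: "is_path T r" "hd r = y" "last r = f (p t)" "set r \<subseteq> f ` {..<t}"
      using reachable_imp_path[of y "f (p t)" T "f ` {..<t}"] y(2) f(2) t by fastforce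
    have path1: "is_path T ((f t # q1) @ y # q2)" using q q' y by simp
    have ft: "f t \<notin> f ` {..<t}"
    proof
      assume "f t \<in> f ` {..<t}"
      then obtain x where "x < t" "f t = f x" by auto
      with inj_onD[OF f(1), of t x] t show False by auto
    qed
    have "is_path T ((f t # q1) @ r)"
    proof (rule is_path_append)
      show "is_path T (f t # q1)" using path1 by (rule is_path_appendD1) simp
      show "set (f t # q1) \<inter> set r = {}" using y(3) r(4) ft by auto
      show "{last (f t # q1), hd r} \<in> edges T" using is_path_append_edge[OF path1] r by simp
    qed (rule r)
    moreover have "y \<noteq> f (p t)" using q(4) q' y no by auto
    with r have "2 \<le> length r" by (cases r rule: rev_cases; cases "butlast r") (auto simp: is_path_def)
    ultimately have "\<exists>c. is_path T c \<and> 3 \<le> length c \<and> {last c, hd c} \<in> edges T"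
      using r pt by (intro exI[of _ "(f t # q1) @ r"]) (auto simp: insert_commute is_path_def)
    with T(4) show False by (simp add: acyclic_graph_def)
  qed
  have node: "\<exists>t<?n. s = f t" if "s \<in> verts T" for s
    using that onto by (metis imageE lessThan_iff)
  have "ordered_decomposition G ?n p (\<lambda>t. \<beta> (f t))"
    unfolding ordered_decomposition_def
  proof (intro conjI ballI allI impI)
    show "\<exists>t<?n. v \<in> \<beta> (f t)" if "v \<in> verts G" for v
      using td(2) node that by blast
    show "\<exists>t<?n. e \<subseteq> \<beta> (f t)" if "e \<in> edges G" for e
      using td(3) node that by blast
    show "\<beta> (f t) \<subseteq> verts G" if "t < ?n" for t
      using td(1) f(2) that by auto
  qed (use n f3 top in auto)
  with f(2) show ?thesis by blast
qed

section \<open>Bags of bounded size and balanced separators\<close>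

lemma ordered_decomposition_of_treewidth:
  assumes "finite (verts G)" "\<forall>e\<in>edges G. e \<subseteq> verts G" "treewidth G \<le> w"
  shows "\<exists>n p B. ordered_decomposition G n p B \<and> (\<forall>t<n. card (B t) \<le> Suc w)"
proof -
  \<comment> \<open>A single bag shows that \<open>LEAST\<close> ranges over a nonempty set, so the
    minimum is attained.\<close>
  have "ordered_decomposition G 1 id (\<lambda>_. verts G)"
    using assms by (auto simp: ordered_decomposition_def)
  then have "\<exists>k (T :: nat ugraph) \<beta>. tree_decomposition G T \<beta> \<and> width T \<beta> = k"
    using ordered_tree_decomposition by blast
  from LeastI_ex[OF this, folded treewidth_def] obtain T :: "nat ugraph" and \<beta> where
    T: "tree_decomposition G T \<beta>" "width T \<beta> = treewidth G"
    by blast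
  have "card (\<beta> t) \<le> Suc w" if "t \<in> verts T" for t
  proof -
    have "finite (verts T)" using T by (auto simp: tree_decomposition_def is_tree_def simple_graph_def)
    with that have "card (\<beta> t) \<le> Max ((\<lambda>t. card (\<beta> t)) ` verts T)" by auto
    \<comment> \<open>Truncated subtraction does no harm: a maximum \<open>m\<close> with
      \<open>m - 1 \<le> w\<close> satisfies \<open>m \<le> Suc w\<close> in any case.\<close>
    with T(2) assms(3) show ?thesis by (simp add: width_def)
  qed
  with ex_ordered_decomposition[OF T(1)] show ?thesis by metis
qed

text \<open>
  The separating bag is the last one below which at least half of the weight is found.
\<close>

lemma balanced_separator:
  assumes od: "ordered_decomposition G n p B" and fin: "finite \<sigma>" and h: "h ` \<sigma> \<subseteq> verts G"
  shows "\<exists>t<n. \<forall>D. D \<inter> B t = {} \<longrightarrow> (\<forall>a\<in>D. \<forall>b\<in>D. (a, b) \<in> (adj G (verts G - B t))\<^sup>*) \<longrightarrow>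
    2 * card {y \<in> \<sigma>. h y \<in> D} \<le> card \<sigma>"
proof -
  have p: "\<And>t. t < n \<Longrightarrow> 0 < t \<Longrightarrow> p t < t" and n: "0 < n"
    and cov: "\<And>v. v \<in> verts G \<Longrightarrow> \<exists>t<n. v \<in> B t" "\<And>e. e \<in> edges G \<Longrightarrow> \<exists>t<n. e \<subseteq> B t"
    and "\<And>s t. t < n \<Longrightarrow> s < t \<Longrightarrow> B t \<inter> B s \<subseteq> B (p t)"
    using od by (auto simp: ordered_decomposition_def)
  then have top: "v \<in> B (p t)" if "t < n" "s < t" "v \<in> B t" "v \<in> B s" for s t v
    using that by blast
  \<comment> \<open>\<open>R\<close> leads from a node to its parent, so \<open>Sub t\<close> is the
    subtree below \<open>t\<close> and \<open>V t\<close> its vertices. A set of vertices is weighed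
    by the number of elements of \<open>\<sigma>\<close> that \<open>h\<close> sends into
    it.\<close>
  define R where "R = {(s, p s) | s. 0 < s \<and> s < n}"
  define Sub where "Sub t = {s. s < n \<and> (s, t) \<in> R\<^sup>*}" for t
  define V where "V t = (\<Union>s\<in>Sub t. B s)" for t
  define heavy where "heavy t \<longleftrightarrow> t < n \<and> card \<sigma> \<le> 2 * card {y \<in> \<sigma>. h y \<in> V t}" for t
  have root: "s \<in> Sub 0" if "s < n" for s
    using that
  proof (induction s rule: less_induct)
    case (less s)
    show ?case
    proof (cases "s = 0")
      case False
      then have "p s \<in> Sub 0" "(s, p s) \<in> R" using less p[of s] by (auto simp: R_def)
      with less.prems show ?thesis by (auto simp: Sub_def intro: converse_rtrancl_into_rtrancl)
    qed (use n in \<open>auto simp: Sub_def\<close>)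
  qed
  have "V 0 \<supseteq> verts G" using cov(1) root unfolding V_def by blast
  then have "{y \<in> \<sigma>. h y \<in> V 0} = \<sigma>" using h by auto
  then have "heavy 0" using n by (simp add: heavy_def)
  moreover have "\<forall>t. heavy t \<longrightarrow> t \<le> n" by (auto simp: heavy_def)
  ultimately have max: "heavy (Greatest heavy)" "\<And>t. heavy t \<Longrightarrow> t \<le> Greatest heavy"
    using GreatestI_nat[of heavy 0 n] Greatest_le_nat[of heavy _ n] by blast+
  define t where "t = Greatest heavy"
  have t: "heavy t" "t < n" using max by (auto simp: t_def heavy_def)
  have light: "2 * card {y \<in> \<sigma>. h y \<in> V c} < card \<sigma>" if "c < n" "t < c" for c
  proof -
    have "\<not> heavy c" using max(2)[of c] that by (auto simp: t_def)
    with that show ?thesis by (simp add: heavy_def)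
  qed
  have step: "s \<in> Sub c" if "p s \<in> Sub c" "0 < s" "s < n" for s c
    using that by (auto simp: Sub_def R_def intro: converse_rtrancl_into_rtrancl)
  have unstep: "p s \<in> Sub c" if "s \<in> Sub c" "s \<noteq> c" for s c
  proof -
    from that have "(s, c) \<in> R\<^sup>*" "s < n" by (auto simp: Sub_def)
    with that obtain u where "(s, u) \<in> R" "(u, c) \<in> R\<^sup>*" by (auto elim: converse_rtranclE)
    with p[of s] show ?thesis by (auto simp: R_def Sub_def)
  qed
  \<comment> \<open>A vertex with bags on both sides of the edge above \<open>c\<close> lies in the
    bag of the parent of \<open>c\<close>. The later of the two nodes moves to its parent, which
    keeps it on its side until the move starts at \<open>c\<close> itself.\<close>
  have leave: "a \<in> B (p c)" if "a \<in> B s" "s \<in> Sub c" "a \<in> B r" "r \<notin> Sub c" "r < n" "0 < c" for a c r s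
    using that(1-5)
  proof (induction "r + s" arbitrary: r s rule: less_induct)
    case less
    have "r \<noteq> s" using less.prems by auto
    have sn: "s < n" using less.prems by (auto simp: Sub_def)
    show ?case
    proof (cases "r < s")
      case True
      then have "a \<in> B (p s)" "p s < s" using top[OF sn True] less.prems p[OF sn] by auto
      with less.prems less.hyps[of r "p s"] unstep[of s c] show ?thesis by (cases "s = c") auto
    next
      case False
      with \<open>r \<noteq> s\<close> have "s < r" by auto
      then have "a \<in> B (p r)" "p r < r" using top[of r s a] less.prems p[of r] by auto
      moreover have "p r \<notin> Sub c" using step[of r c] less.prems \<open>s < r\<close> by auto
      ultimately show ?thesis using less.prems less.hyps[of "p r" s] by auto
    qed
  qed
  \<comment> \<open>If \<open>D\<close> misses the subtree of \<open>t\<close>, the heavy half lies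
    outside \<open>D\<close>. Otherwise \<open>D\<close>, unable to cross \<open>B t\<close>, stays
    below a single child \<open>c\<close>, which is light because its number exceeds that of the
    last heavy node.\<close>
  have "2 * card {y \<in> \<sigma>. h y \<in> D} \<le> card \<sigma>"
    if D: "D \<inter> B t = {}" "\<forall>a\<in>D. \<forall>b\<in>D. (a, b) \<in> (adj G (verts G - B t))\<^sup>*" for D
  proof (cases "D \<inter> V t = {}")
    case True
    then have "card {y \<in> \<sigma>. h y \<in> D} + card {y \<in> \<sigma>. h y \<in> V t}
      = card ({y \<in> \<sigma>. h y \<in> D} \<union> {y \<in> \<sigma>. h y \<in> V t})"
      using fin by (intro card_Un_disjoint[symmetric]) auto
    also have "\<dots> \<le> card \<sigma>" using fin by (intro card_mono) auto
    finally show ?thesis using t(1) by (auto simp: heavy_def)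
  next
    case False
    then obtain d s where d: "d \<in> D" "d \<in> B s" "s \<in> Sub t" by (auto simp: V_def)
    then have "s \<noteq> t" using D(1) by auto
    have "(s, t) \<in> R\<^sup>*" using d by (auto simp: Sub_def)
    with \<open>s \<noteq> t\<close> obtain c where "(s, c) \<in> R\<^sup>*" "(c, t) \<in> R" by (auto elim: rtranclE)
    then have c: "s \<in> Sub c" "p c = t" "0 < c" "c < n" using d by (auto simp: Sub_def R_def)
    then have tc: "t < c" using p by auto
    have "b \<in> V c" if "(d, b) \<in> (adj G (verts G - B t))\<^sup>*" for b
      using that
    proof (induction rule: rtrancl_induct)
      case base
      show ?case using d c by (auto simp: V_def)
    next
      case (step a b)
      from step(2) have ab: "{a, b} \<in> edges G" "a \<notin> B t" by (auto simp: adj_def)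
      from cov(2)[OF ab(1)] obtain r where r: "r < n" "a \<in> B r" "b \<in> B r" by auto
      from step(3) obtain s where "a \<in> B s" "s \<in> Sub c" by (auto simp: V_def)
      with leave[of a s c r] r c ab have "r \<in> Sub c" by auto
      with r show ?case by (auto simp: V_def)
    qed
    with D d have "D \<subseteq> V c" by auto
    then have "card {y \<in> \<sigma>. h y \<in> D} \<le> card {y \<in> \<sigma>. h y \<in> V c}"
      using fin by (intro card_mono) auto
    with light[OF c(4) tc] show ?thesis by auto
  qed
  with t(2) show ?thesis by blast
qed

section \<open>Construction of the decomposition\<close>

definition boundary :: "'a ugraph \<Rightarrow> 'a set \<Rightarrow> 'a set" where
  "boundary G K = {y \<in> verts G - K. \<exists>x\<in>K. {x, y} \<in> edges G}"

definition component :: "'a ugraph \<Rightarrow> 'a set \<Rightarrow> 'a \<Rightarrow> 'a set" where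
  "component G W v = {y. (v, y) \<in> (adj G W)\<^sup>*}"

lemma component_self: "v \<in> component G W v"
  by (simp add: component_def)

lemma component_subset: "v \<in> W \<Longrightarrow> component G W v \<subseteq> W"
  by (auto simp: component_def intro: adj_rtrancl_in)

lemma component_connected:
  assumes "a \<in> component G W v" "b \<in> component G W v"
  shows "(a, b) \<in> (adj G (component G W v))\<^sup>*"
proof -
  have "(v, y) \<in> (adj G (component G W v))\<^sup>*" if "(v, y) \<in> (adj G W)\<^sup>*" for y
    using that
  proof (induction rule: rtrancl_induct)
    case (step x y)
    then have "(x, y) \<in> adj G (component G W v)"
      by (auto simp: adj_def component_def intro: rtrancl_into_rtrancl)
    with step show ?case by auto
  qed auto
  then have *: "(v, y) \<in> (adj G (component G W v))\<^sup>*" if "y \<in> component G W v" for y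
    using that by (simp add: component_def)
  show ?thesis using *[OF assms(1)] *[OF assms(2)] by (meson adj_rtrancl_sym rtrancl_trans)
qed

lemma boundary_component:
  assumes "v \<in> W"
  shows "boundary G (component G W v) \<inter> W = {}"
proof -
  have "y \<in> component G W v" if "x \<in> component G W v" "{x, y} \<in> edges G" "y \<in> W" for x y
  proof -
    have "x \<in> W" using component_subset[OF assms] that by blast
    with that have "(x, y) \<in> adj G W" by (auto simp: adj_def)
    with that show ?thesis by (auto simp: component_def)
  qed
  then show ?thesis by (auto simp: boundary_def)
qed

lemma component_mono: "W \<subseteq> W' \<Longrightarrow> component G W v \<subseteq> component G W' v"
  by (auto simp: component_def intro: adj_rtrancl_mono)

lemma component_eq: "u \<in> component G W v \<Longrightarrow> component G W u = component G W v"
  unfolding component_def by (auto intro: rtrancl_trans adj_rtrancl_sym)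

lemma component_remove:
  assumes "component G W v \<inter> X = {}"
  shows "component G (W - X) v = component G W v"
proof
  show "component G W v \<subseteq> component G (W - X) v"
  proof
    fix y assume "y \<in> component G W v"
    then have "(v, y) \<in> (adj G W)\<^sup>*" by (simp add: component_def)
    then show "y \<in> component G (W - X) v"
    proof (induction rule: rtrancl_induct)
      case (step x y)
      then have "x \<in> component G W v" "y \<in> component G W v"
        by (auto simp: component_def)
      with assms step have "(x, y) \<in> adj G (W - X)" by (auto simp: adj_def)
      with step show ?case by (auto simp: component_def)
    qed (simp add: component_self)
  qed
qed (auto intro: component_mono[THEN subsetD])

section \<open>One node of the decomposition\<close>

text \<open>The value is the fixed point of \<open>x = x / 2 + 1 + s * k + k\<close>: half of the
  old boundary, the vertex \<open>v\<close>, the hitting sets of \<open>k\<close> colors, and one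
  further vertex of each of these colors.\<close>

definition max_adhesion :: "nat \<Rightarrow> nat \<Rightarrow> nat" where
  "max_adhesion s k = 2 * (s + 1) * k + 2"

text \<open>The locale isolates what the hypotheses are needed for: hitting sets come from the
  absence of flowers, separators from the treewidth. Separators consist of colors, while the weights
  they balance are carried by vertices of \<open>H\<close>.\<close>

locale separated_coloring =
  fixes H :: "'a ugraph" and col :: "'a \<Rightarrow> 'c" and S :: "'c \<Rightarrow> 'a set" and s k :: nat
  assumes simple: "simple_graph H"
    and S_subset: "\<And>i. i \<in> colors H col \<Longrightarrow> S i \<subseteq> verts H"
    and card_S: "\<And>i. i \<in> colors H col \<Longrightarrow> card (S i) \<le> s"
    and S_hits: "\<And>i a b. i \<in> colors H col \<Longrightarrow> a \<in> color_class H col i - S i \<Longrightarrow>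
      b \<in> color_class H col i - S i \<Longrightarrow> a \<noteq> b \<Longrightarrow>
      (a, b) \<notin> (adj (bullet_except H col i) (verts H - S i))\<^sup>*"
    and separator: "\<And>\<sigma>. \<sigma> \<subseteq> verts H \<Longrightarrow> \<exists>X\<subseteq>colors H col. card X \<le> k \<and>
      (\<forall>D. D \<inter> X = {} \<longrightarrow> (\<forall>a\<in>D. \<forall>b\<in>D. (a, b) \<in> (adj (hat H col) (colors H col - X))\<^sup>*) \<longrightarrow>
        2 * card {y \<in> \<sigma>. col y \<in> D} \<le> card \<sigma>)"
begin

abbreviation "G \<equiv> bullet H col"
abbreviation "V \<equiv> verts H"

definition conn :: "'c \<Rightarrow> 'a \<Rightarrow> 'a \<Rightarrow> bool" where
  "conn i a b \<longleftrightarrow> (a, b) \<in> (adj (bullet_except H col i) (V - S i))\<^sup>*"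

lemma finV: "finite V"
  using simple by (simp add: simple_graph_def)

lemma fin_sub: "A \<subseteq> V \<Longrightarrow> finite A"
  using finV by (rule finite_subset[rotated])

lemma verts_G: "verts G = V"
  by (simp add: bullet_def make_cliques_def)

lemma edge_in: "{a, b} \<in> edges H \<Longrightarrow> a \<in> V \<and> b \<in> V \<and> a \<noteq> b"
  using simple by (force simp: simple_graph_def)

lemma edge_G_iff:
  "{a, b} \<in> edges G \<longleftrightarrow> {a, b} \<in> edges H \<or> (a \<noteq> b \<and> a \<in> V \<and> b \<in> V \<and> col a = col b)"
  by (auto simp: bullet_def make_cliques_def color_class_def colors_def doubleton_eq_iff)

lemma edge_G_in: "{a, b} \<in> edges G \<Longrightarrow> a \<in> V \<and> b \<in> V \<and> a \<noteq> b"
  using edge_in by (auto simp: edge_G_iff)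

lemma edge_G_except:
  "{a, b} \<in> edges G \<Longrightarrow> col a \<noteq> i \<or> col b \<noteq> i \<Longrightarrow> {a, b} \<in> edges (bullet_except H col i)"
  unfolding edge_G_iff
  by (auto simp: bullet_except_def make_cliques_def color_class_def colors_def doubleton_eq_iff)

lemma edge_H_except: "{a, b} \<in> edges H \<Longrightarrow> {a, b} \<in> edges (bullet_except H col i)"
  by (auto simp: bullet_except_def make_cliques_def)

lemma conn_unique:
  assumes "a \<in> V - S (col a)" "b \<in> V - S (col a)" "col b = col a" "conn (col a) a b"
  shows "a = b"
  using S_hits[of "col a" a b] assms by (auto simp: conn_def color_class_def colors_def)

lemma conn_trans: "conn i a b \<Longrightarrow> conn i b c \<Longrightarrow> conn i a c"
  unfolding conn_def by (rule rtrancl_trans)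

lemma conn_sym: "conn i a b \<Longrightarrow> conn i b a"
  unfolding conn_def by (rule adj_rtrancl_sym)

lemma conn_edge:
  "{a, b} \<in> edges G \<Longrightarrow> col a \<noteq> i \<or> col b \<noteq> i \<Longrightarrow> a \<notin> S i \<Longrightarrow> b \<notin> S i \<Longrightarrow> conn i a b"
  unfolding conn_def using edge_G_except edge_G_in by (intro r_into_rtrancl) (auto simp: adj_def)

text \<open>As color \<open>j\<close> forms a clique, the choice of \<open>S i\<close> leaves at most one such vertex.\<close>

definition special :: "'c \<Rightarrow> 'c \<Rightarrow> 'a set" where
  "special i j = {a \<in> V - S i. col a = i \<and> (\<exists>b\<in>V - S i. col b = j \<and> conn i a b)}"

lemma card_special:
  assumes "i \<noteq> j"
  shows "card (special i j) \<le> 1"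
proof -
  have "a = a'" if aa: "a \<in> special i j" "a' \<in> special i j" for a a'
  proof -
    from aa obtain b b' where b: "b \<in> V - S i" "col b = j" "conn i a b" "b' \<in> V - S i" "col b' = j"
      "conn i a' b'" by (auto simp: special_def)
    have "conn i b b'"
    proof (cases "b = b'")
      case False
      with b show ?thesis using assms by (intro conn_edge) (auto simp: edge_G_iff)
    qed (simp add: conn_def)
    then have "conn i a a'" using b by (meson conn_trans conn_sym)
    with aa show ?thesis by (intro conn_unique) (auto simp: special_def)
  qed
  then show ?thesis by (metis card_le_Suc0_iff_eq One_nat_def card.infinite le0)
qed

text \<open>Without vertices of color \<open>i\<close>, no edge inside \<open>K\<close> comes from
  the clique missing in \<open>bullet_except H col i\<close>, so connectivity carries over.\<close>

lemma conn_set: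
  assumes "\<forall>a\<in>K. \<forall>b\<in>K. (a, b) \<in> (adj G K)\<^sup>*" "K \<subseteq> V" "K \<inter> S i = {}" "\<forall>a\<in>K. col a \<noteq> i"
    "a \<in> K" "b \<in> K"
  shows "conn i a b"
proof -
  have "(a, b) \<in> (adj G K)\<^sup>*" using assms by blast
  then show ?thesis
  proof (induction rule: rtrancl_induct)
    case (step y z)
    then have "conn i y z" using assms by (intro conn_edge) (auto simp: adj_def)
    with step show ?case by (meson conn_trans)
  qed (simp add: conn_def)
qed

text \<open>A walk projects to its colors: an edge between different colors is an edge of
  \<open>H\<close> and becomes an edge of \<open>hat H col\<close>, and any other edge stays at one
  color.\<close>

lemma colors_connected:
  assumes "\<forall>a\<in>K. \<forall>b\<in>K. (a, b) \<in> (adj G K)\<^sup>*" "K \<subseteq> V" "col ` K \<inter> X = {}" "i \<in> col ` K" "j \<in> col ` K"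
  shows "(i, j) \<in> (adj (hat H col) (colors H col - X))\<^sup>*"
proof -
  from assms(4,5) obtain a b where ab: "a \<in> K" "i = col a" "b \<in> K" "j = col b" by blast
  with assms have "(a, b) \<in> (adj G K)\<^sup>*" by blast
  then have "(col a, col b) \<in> (adj (hat H col) (colors H col - X))\<^sup>*"
  proof (induction rule: rtrancl_induct)
    case (step y z)
    then have yz: "{y, z} \<in> edges G" "y \<in> K" "z \<in> K" by (auto simp: adj_def)
    show ?case
    proof (cases "col y = col z")
      case False
      with yz have e: "{y, z} \<in> edges H" by (auto simp: edge_G_iff)
      have "{col y, col z} \<in> edges (hat H col)"
        using e False edge_in[OF e] by (auto simp: hat_def color_class_def)
      moreover have "col y \<in> colors H col - X" "col z \<in> colors H col - X"
        using yz assms(2,3) by (auto simp: colors_def)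
      ultimately have "(col y, col z) \<in> adj (hat H col) (colors H col - X)"
        by (auto simp: adj_def)
      with step show ?thesis by auto
    qed (use step in simp)
  qed auto
  with ab show ?thesis by simp
qed

text \<open>The summands count the inherited boundary, the vertex \<open>v\<close>, the hitting sets
  of the colors in \<open>X\<close>, and one special vertex for each ordered pair of these
  colors.\<close>

definition guard_bound :: nat where
  "guard_bound = max_adhesion s k + 1 + s * k + k * k"

text \<open>Putting \<open>v\<close> into the guard ensures progress even if no other chosen vertex
  lies in \<open>K\<close>. The last clause makes every remaining component a valid input again,
  with the same bound on its boundary.\<close>

lemma ex_node:
  assumes K: "K \<subseteq> V" "v \<in> K" and \<sigma>: "card (boundary G K) \<le> max_adhesion s k"
  shows "\<exists>bag g. v \<in> g \<and> boundary G K \<subseteq> g \<and> g \<subseteq> bag \<and> bag \<subseteq> K \<union> boundary G K \<and>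
    (\<forall>a\<in>bag. \<forall>b\<in>bag. {a, b} \<in> edges H \<longrightarrow> a \<in> g \<or> b \<in> g) \<and>
    card g \<le> guard_bound \<and> card (col ` bag) \<le> guard_bound + k \<and>
    (\<forall>K'. K' \<subseteq> K - bag \<longrightarrow> K' \<noteq> {} \<longrightarrow> (\<forall>a\<in>K'. \<forall>b\<in>K'. (a, b) \<in> (adj G K')\<^sup>*) \<longrightarrow>
      boundary G K' \<subseteq> bag \<longrightarrow>
      card (boundary G K') \<le> max_adhesion s k \<and> card (boundary G K' - g) \<le> 1)"
proof -
  define \<sigma> where "\<sigma> = boundary G K"
  have \<sigma>V: "\<sigma> \<subseteq> V" "\<sigma> \<inter> K = {}" by (auto simp: \<sigma>_def boundary_def verts_G)
  from separator[OF \<sigma>V(1)] obtain X where X: "X \<subseteq> colors H col" "card X \<le> k"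
    and bal: "\<And>D. D \<inter> X = {} \<Longrightarrow> (\<forall>a\<in>D. \<forall>b\<in>D. (a, b) \<in> (adj (hat H col) (colors H col - X))\<^sup>*) \<Longrightarrow>
        2 * card {y \<in> \<sigma>. col y \<in> D} \<le> card \<sigma>" by blast
  have finX: "finite X" using X(1) finV by (auto simp: colors_def intro: finite_subset)
  define SX where "SX = (\<Union>i\<in>X. S i)"
  define Q where "Q = (\<Union>i\<in>X. \<Union>j\<in>X - {i}. special i j)"
  define g where "g = \<sigma> \<union> {v} \<union> ((SX \<union> Q) \<inter> K)"
  define bag where "bag = g \<union> {a \<in> K. col a \<in> X}"
  have cSX: "card SX \<le> s * k"
  proof -
    have "card SX \<le> (\<Sum>i\<in>X. card (S i))" unfolding SX_def using finX by (rule card_UN_le)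
    also have "\<dots> \<le> (\<Sum>i\<in>X. s)" using X(1) card_S by (intro sum_mono) auto
    also have "\<dots> \<le> s * k" using X(2) by (simp add: mult.commute)
    finally show ?thesis .
  qed
  have cQ: "card Q \<le> k * k"
  proof -
    have "card Q \<le> (\<Sum>i\<in>X. card (\<Union>j\<in>X - {i}. special i j))"
      unfolding Q_def using finX by (rule card_UN_le)
    also have "\<dots> \<le> (\<Sum>i\<in>X. card X)"
    proof (rule sum_mono)
      fix i
      have "card (\<Union>j\<in>X - {i}. special i j) \<le> (\<Sum>j\<in>X - {i}. card (special i j))"
        using finX by (intro card_UN_le) auto
      also have "\<dots> \<le> (\<Sum>j\<in>X - {i}. 1)" by (intro sum_mono card_special) auto
      also have "\<dots> \<le> card X" using finX by (simp add: card_mono)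
      finally show "card (\<Union>j\<in>X - {i}. special i j) \<le> card X" .
    qed
    also have "\<dots> \<le> k * k" using X(2) by (simp add: mult_le_mono)
    finally show ?thesis .
  qed
  have SXV: "SX \<subseteq> V" using S_subset X(1) by (auto simp: SX_def)
  have QV: "Q \<subseteq> V" by (auto simp: Q_def special_def)
  have gV: "g \<subseteq> V" using \<sigma>V K SXV by (auto simp: g_def)
  have cg: "card g \<le> guard_bound"
  proof -
    have "card ((SX \<union> Q) \<inter> K) \<le> card (SX \<union> Q)"
      using fin_sub[OF SXV] fin_sub[OF QV] by (intro card_mono) auto
    also have "\<dots> \<le> card SX + card Q" by (rule card_Un_le)
    finally have "card ((SX \<union> Q) \<inter> K) \<le> s * k + k * k" using cSX cQ by simp
    moreover have "card g \<le> card (\<sigma> \<union> {v}) + card ((SX \<union> Q) \<inter> K)" unfolding g_def by (rule card_Un_le)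
    moreover have "card (\<sigma> \<union> {v}) \<le> card \<sigma> + 1" using card_Un_le[of \<sigma> "{v}"] by simp
    ultimately show ?thesis using \<sigma> unfolding guard_bound_def \<sigma>_def by linarith
  qed
  have ccol: "card (col ` bag) \<le> guard_bound + k"
  proof -
    have "card (col ` bag) \<le> card (col ` g \<union> X)"
      using fin_sub[OF gV] finX by (intro card_mono) (auto simp: bag_def)
    also have "\<dots> \<le> card (col ` g) + card X" by (rule card_Un_le)
    also have "card (col ` g) \<le> card g" using fin_sub[OF gV] by (rule card_image_le)
    finally show ?thesis using cg X(2) by simp
  qed
  \<comment> \<open>Two such vertices of equal color would contradict the choice of
    \<open>S\<close>, and for different colors \<open>a\<close> would be special and hence in the
    guard. The fact is used twice: an edge of \<open>H\<close> is a connection, which gives the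
    vertex cover, and so is a detour through a remaining component, which gives the bound on child
    adhesions.\<close>
  have apart: False
    if a: "a \<in> bag - g" and b: "b \<in> bag - g" and ab: "a \<noteq> b" "conn (col a) a b" for a b
  proof -
    from a have a': "a \<in> K" "col a \<in> X" "a \<notin> SX" "a \<notin> Q" by (auto simp: bag_def g_def)
    from b have b': "b \<in> K" "col b \<in> X" "b \<notin> SX" by (auto simp: bag_def g_def)
    have S: "a \<in> V - S (col a)" "b \<in> V - S (col a)" using a' b' K by (auto simp: SX_def)
    show False
    proof (cases "col a = col b")
      case True
      with conn_unique[OF S] ab show False by simp
    next
      case False
      with S ab a' b' have "a \<in> special (col a) (col b)" by (auto simp: special_def)
      with a' b' False show False by (auto simp: Q_def)
    qed
  qed
  have cover: "a \<in> g \<or> b \<in> g" if "a \<in> bag" "b \<in> bag" "{a, b} \<in> edges H" for a b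
  proof (rule ccontr)
    assume no: "\<not> (a \<in> g \<or> b \<in> g)"
    with that have "a \<notin> SX" "b \<notin> SX" "col a \<in> X" by (auto simp: bag_def g_def)
    then have "conn (col a) a b" using that(3) edge_H_except[OF that(3)] edge_in[OF that(3)]
      unfolding conn_def by (intro r_into_rtrancl) (auto simp: adj_def SX_def)
    with apart[of a b] no that edge_in[OF that(3)] show False by blast
  qed
  have new: "card (boundary G K') \<le> max_adhesion s k \<and> card (boundary G K' - g) \<le> 1"
    if K': "K' \<subseteq> K - bag" "K' \<noteq> {}" "\<forall>a\<in>K'. \<forall>b\<in>K'. (a, b) \<in> (adj G K')\<^sup>*" "boundary G K' \<subseteq> bag"
    for K'
  proof -
    let ?N = "boundary G K'"
    have NV: "?N \<subseteq> V" by (auto simp: boundary_def verts_G)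
    have K'V: "K' \<subseteq> V" using K' K by auto
    have K'X: "\<forall>x\<in>K'. col x \<notin> X" "K' \<inter> SX = {}" using K' by (auto simp: bag_def g_def)
    \<comment> \<open>\<open>K'\<close> avoids \<open>S i\<close> and all colors of
      \<open>X\<close>. Hence a detour through \<open>K'\<close> survives the removal of the clique
      on \<open>i\<close>, even when its ends have color \<open>i\<close> themselves.\<close>
    have N_conn: "conn i a b" if i: "i \<in> X" "a \<in> ?N - S i" "b \<in> ?N - S i" and "col b = i \<or> col b \<in> X"
      for i a b
    proof -
      from i obtain x y where xy: "x \<in> K'" "{x, a} \<in> edges G" "y \<in> K'" "{y, b} \<in> edges G"
        by (auto simp: boundary_def)
      have "K' \<inter> S i = {}" "\<forall>x\<in>K'. col x \<noteq> i" using K'X i by (auto simp: SX_def)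
      then have "conn i x y" "conn i x a" "conn i y b"
        using conn_set[OF K'(3) K'V, of i x y] xy i by (auto intro!: conn_edge)
      then show ?thesis by (meson conn_trans conn_sym)
    qed
    have "card (?N - g) \<le> 1"
    proof (rule ccontr)
      assume "\<not> card (?N - g) \<le> 1"
      then obtain a b where ab: "a \<in> ?N - g" "b \<in> ?N - g" "a \<noteq> b"
        by (metis One_nat_def card_le_Suc0_iff_eq card.infinite le0)
      with K'(4) have "a \<in> bag - g" "b \<in> bag - g" by auto
      moreover from this have "conn (col a) a b"
        using ab by (intro N_conn) (auto simp: bag_def g_def SX_def)
      ultimately show False using apart ab by blast
    qed
    moreover have "card ?N \<le> max_adhesion s k"
    proof -
      \<comment> \<open>Adding the boundary vertices with colors outside \<open>X\<close> keeps the
        set connected, so their colors belong to one component \<open>D\<close> of the graph of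
        colors minus \<open>X\<close>. Balance then limits how many of them can be inherited from
        \<open>\<sigma>\<close>.\<close>
      define Y where "Y = {y \<in> ?N. col y \<notin> X}"
      define D where "D = col ` (K' \<union> Y)"
      have YK: "\<forall>a\<in>K' \<union> Y. \<forall>b\<in>K' \<union> Y. (a, b) \<in> (adj G (K' \<union> Y))\<^sup>*"
      proof -
        have "\<exists>x\<in>K'. (a, x) \<in> (adj G (K' \<union> Y))\<^sup>*" if "a \<in> K' \<union> Y" for a
        proof (cases "a \<in> K'")
          case False
          with that obtain x where "x \<in> K'" "{x, a} \<in> edges G" by (auto simp: Y_def boundary_def)
          moreover from this that have "(a, x) \<in> adj G (K' \<union> Y)"
            by (auto simp: adj_def insert_commute)
          ultimately show ?thesis by auto
        qed auto
        moreover have "(x, y) \<in> (adj G (K' \<union> Y))\<^sup>*" if "x \<in> K'" "y \<in> K'" for x y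
          using K'(3) that by (auto intro: adj_rtrancl_mono)
        ultimately show ?thesis by (meson adj_rtrancl_sym rtrancl_trans)
      qed
      have DX: "D \<inter> X = {}" using K'X by (auto simp: D_def Y_def)
      have "K' \<union> Y \<subseteq> V" using K'V NV by (auto simp: Y_def)
      with YK DX have "2 * card {y \<in> \<sigma>. col y \<in> D} \<le> card \<sigma>"
        by (intro bal ballI colors_connected) (auto simp: D_def)
      moreover define R where "R i = {y \<in> ?N - S i. col y = i}" for i
      have "card (R i) \<le> 1" if "i \<in> X" for i
      proof -
        have "a = b" if "a \<in> R i" "b \<in> R i" for a b
          using that N_conn[of i a b] \<open>i \<in> X\<close> NV by (intro conn_unique) (auto simp: R_def)
        then show ?thesis by (metis One_nat_def card_le_Suc0_iff_eq card.infinite le0)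
      qed
      then have "(\<Sum>i\<in>X. card (R i)) \<le> (\<Sum>i\<in>X. 1)" by (intro sum_mono)
      then have "card (\<Union>i\<in>X. R i) \<le> k" using card_UN_le[OF finX, of R] X(2) by simp
      \<comment> \<open>A boundary vertex with color outside \<open>X\<close> entered the bag
        through \<open>\<sigma>\<close>, \<open>v\<close> or \<open>SX\<close>, since
        \<open>Q\<close> and the added classes have colors in \<open>X\<close>. Any other one, of
        color \<open>i\<close>, lies in \<open>S i\<close> or in \<open>R i\<close>.\<close>
      moreover have "?N \<subseteq> {y \<in> \<sigma>. col y \<in> D} \<union> {v} \<union> SX \<union> (\<Union>i\<in>X. R i)"
      proof
        fix y assume y: "y \<in> ?N"
        show "y \<in> {y \<in> \<sigma>. col y \<in> D} \<union> {v} \<union> SX \<union> (\<Union>i\<in>X. R i)"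
        proof (cases "col y \<in> X")
          case True
          with y show ?thesis by (auto simp: SX_def R_def)
        next
          case False
          with y have "y \<in> Y" by (auto simp: Y_def)
          moreover have "y \<notin> Q" using False by (auto simp: Q_def special_def)
          ultimately show ?thesis using y K'(4) False by (auto simp: bag_def g_def D_def)
        qed
      qed
      then have "card ?N \<le> card ({y \<in> \<sigma>. col y \<in> D} \<union> {v} \<union> SX \<union> (\<Union>i\<in>X. R i))"
        using \<sigma>V(1) SXV K NV by (intro card_mono) (auto intro!: fin_sub simp: R_def)
      moreover have "\<dots> \<le> card {y \<in> \<sigma>. col y \<in> D} + card {v} + card SX + card (\<Union>i\<in>X. R i)"
        by (meson add_le_mono1 card_Un_le order_trans)
      ultimately have "card ?N \<le> card {y \<in> \<sigma>. col y \<in> D} + 1 + s * k + k" using cSX by simp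
      moreover have "2 * card {y \<in> \<sigma>. col y \<in> D} \<le> max_adhesion s k"
        using \<open>2 * _ \<le> card \<sigma>\<close> \<sigma> by (simp add: \<sigma>_def)
      ultimately show ?thesis by (simp add: max_adhesion_def algebra_simps)
    qed
    ultimately show ?thesis by simp
  qed
  have subs: "v \<in> g" "\<sigma> \<subseteq> g" "g \<subseteq> bag" "bag \<subseteq> K \<union> \<sigma>" using K by (auto simp: bag_def g_def)
  show ?thesis unfolding \<sigma>_def[symmetric]
  proof (rule exI[of _ bag], rule exI[of _ g], intro conjI ballI allI impI)
    fix K' assume "K' \<subseteq> K - bag" "K' \<noteq> {}" "\<forall>a\<in>K'. \<forall>b\<in>K'. (a, b) \<in> (adj G K')\<^sup>*" "boundary G K' \<subseteq> bag"
    from new[OF this] show "card (boundary G K') \<le> max_adhesion s k" "card (boundary G K' - g) \<le> 1"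
      by blast+
  qed (fact cg ccol subs | erule (2) cover)+
qed

section \<open>Growing the decomposition node by node\<close>

text \<open>Edges are required in a bag only if both ends are covered already, which makes this an
  invariant of the growth.\<close>

definition partial_decomposition ::
  "nat \<Rightarrow> (nat \<Rightarrow> nat) \<Rightarrow> (nat \<Rightarrow> 'a set) \<Rightarrow> (nat \<Rightarrow> 'a set) \<Rightarrow> bool" where
  "partial_decomposition n p B g \<longleftrightarrow> 0 < n \<and>
     (\<forall>t<n. (0 < t \<longrightarrow> p t < t \<and> B t \<inter> B (p t) \<subseteq> g t \<and> card (B t \<inter> B (p t) - g (p t)) \<le> 1) \<and>
        g t \<subseteq> B t \<and> B t \<subseteq> V \<and> (\<forall>a\<in>B t. \<forall>b\<in>B t. {a, b} \<in> edges H \<longrightarrow> a \<in> g t \<or> b \<in> g t) \<and>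
        card (g t) \<le> guard_bound \<and> card (col ` B t) \<le> guard_bound + k \<and>
        (\<forall>s<t. B t \<inter> B s \<subseteq> B (p t))) \<and>
     (\<forall>a b. {a, b} \<in> edges G \<longrightarrow> a \<in> (\<Union>t<n. B t) \<longrightarrow> b \<in> (\<Union>t<n. B t) \<longrightarrow>
        (\<exists>t<n. a \<in> B t \<and> b \<in> B t))"

text \<open>
  Every component of what remains is attached to a single node in a way that allows it to be
  decomposed below that node.
\<close>

definition extendable :: "nat \<Rightarrow> (nat \<Rightarrow> 'a set) \<Rightarrow> (nat \<Rightarrow> 'a set) \<Rightarrow> bool" where
  "extendable n B g \<longleftrightarrow> (\<forall>v\<in>V - (\<Union>t<n. B t). \<exists>t<n.
     let N = boundary G (component G (V - (\<Union>t<n. B t)) v)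
     in N \<subseteq> B t \<and> card N \<le> max_adhesion s k \<and> card (N - g t) \<le> 1)"

lemma extend:
  assumes pd: "partial_decomposition n p B g" and ext: "extendable n B g"
    and v: "v \<in> V - (\<Union>t<n. B t)"
  shows "\<exists>p B' g. partial_decomposition (Suc n) p B' g \<and> extendable (Suc n) B' g \<and>
    (\<Union>t<n. B t) \<subset> (\<Union>t<Suc n. B' t)"
proof -
  define U where "U = (\<Union>t<n. B t)"
  define K where "K = component G (V - U) v"
  define \<sigma> where "\<sigma> = boundary G K"
  have vW: "v \<in> V - U" using v by (simp add: U_def)
  have KU: "K \<subseteq> V - U" unfolding K_def by (rule component_subset[OF vW])
  have vK: "v \<in> K" unfolding K_def by (rule component_self)
  have \<sigma>U: "\<sigma> \<subseteq> U" using boundary_component[OF vW, of G]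
    by (auto simp: \<sigma>_def K_def boundary_def verts_G)
  from ext v obtain q where q: "q < n" "\<sigma> \<subseteq> B q" "card \<sigma> \<le> max_adhesion s k" "card (\<sigma> - g q) \<le> 1"
    unfolding extendable_def U_def[symmetric] Let_def K_def \<sigma>_def by blast
  have "K \<subseteq> V" using KU by blast
  from ex_node[OF this vK q(3)[unfolded \<sigma>_def]] obtain bag gd where
    node: "v \<in> gd" "\<sigma> \<subseteq> gd" "gd \<subseteq> bag" "bag \<subseteq> K \<union> \<sigma>"
      "\<forall>a\<in>bag. \<forall>b\<in>bag. {a, b} \<in> edges H \<longrightarrow> a \<in> gd \<or> b \<in> gd"
      "card gd \<le> guard_bound" "card (col ` bag) \<le> guard_bound + k"
    and new: "\<forall>K'. K' \<subseteq> K - bag \<longrightarrow> K' \<noteq> {} \<longrightarrow> (\<forall>a\<in>K'. \<forall>b\<in>K'. (a, b) \<in> (adj G K')\<^sup>*) \<longrightarrow>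
      boundary G K' \<subseteq> bag \<longrightarrow> card (boundary G K') \<le> max_adhesion s k \<and> card (boundary G K' - gd) \<le> 1"
    unfolding \<sigma>_def[symmetric] by (elim exE conjE) (rule that; assumption)
  have edges: "\<forall>a b. {a, b} \<in> edges G \<longrightarrow> a \<in> U \<longrightarrow> b \<in> U \<longrightarrow> (\<exists>t<n. a \<in> B t \<and> b \<in> B t)"
    using pd unfolding partial_decomposition_def U_def by (elim conjE)
  define p' B' g' where "p' = p(n := q)" and "B' = B(n := bag)" and "g' = g(n := gd)"
  have n: "0 < n" using pd by (simp add: partial_decomposition_def)
  have old: "B' t = B t" "g' t = g t" "p' t = p t" if "t < n" for t
    using that by (auto simp: p'_def B'_def g'_def)
  have at_n: "B' n = bag" "g' n = gd" "p' n = q" by (auto simp: p'_def B'_def g'_def)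
  have U': "(\<Union>t<Suc n. B' t) = U \<union> bag"
    using at_n old by (auto simp: U_def lessThan_Suc)
  \<comment> \<open>The new bag meets the covered vertices exactly in \<open>\<sigma>\<close>, which
    lies in \<open>B q\<close>. This yields the clauses on adhesions and on earlier bags.\<close>
  have bagU: "bag \<inter> U = \<sigma>" using node KU \<sigma>U by blast
  have BU: "B t \<subseteq> U" if "t < n" for t using that by (auto simp: U_def)
  have bagq: "bag \<inter> B q = \<sigma>" using bagU BU[OF q(1)] q(2) by blast
  have "partial_decomposition (Suc n) p' B' g'"
    unfolding partial_decomposition_def
  proof (intro conjI)
    show "\<forall>t<Suc n.
       (0 < t \<longrightarrow> p' t < t \<and> B' t \<inter> B' (p' t) \<subseteq> g' t \<and> card (B' t \<inter> B' (p' t) - g' (p' t)) \<le> 1) \<and>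
       g' t \<subseteq> B' t \<and> B' t \<subseteq> V \<and>
       (\<forall>a\<in>B' t. \<forall>b\<in>B' t. {a, b} \<in> edges H \<longrightarrow> a \<in> g' t \<or> b \<in> g' t) \<and>
       card (g' t) \<le> guard_bound \<and> card (col ` B' t) \<le> guard_bound + k \<and>
       (\<forall>s<t. B' t \<inter> B' s \<subseteq> B' (p' t))" (is "\<forall>t<_. ?P t")
    proof (intro allI impI)
      fix t assume "t < Suc n"
      then consider "t < n" | "t = n" by linarith
      then show "?P t"
      proof cases
        case 1
        with pd have P: "0 < t \<longrightarrow> p t < t" unfolding partial_decomposition_def by blast
        have "p t < n" if "0 < t" using P 1 that by auto
        with 1 pd old(1)[of "p t"] old(2)[of "p t"] old[of t] P show ?thesis
          unfolding partial_decomposition_def by (cases "t = 0") (auto simp: old)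
      next
        case 2
        have "\<forall>s<n. bag \<inter> B s \<subseteq> B q" using BU bagU q(2) by blast
        moreover have "bag \<subseteq> V" using node(4) KU by (auto simp: \<sigma>_def boundary_def verts_G)
        ultimately show ?thesis using node q 2 old(1,2)[OF q(1)] old(1) at_n bagq by auto
      qed
    qed
    show "\<forall>a b. {a, b} \<in> edges G \<longrightarrow> a \<in> (\<Union>t<Suc n. B' t) \<longrightarrow> b \<in> (\<Union>t<Suc n. B' t) \<longrightarrow>
        (\<exists>t<Suc n. a \<in> B' t \<and> b \<in> B' t)"
    proof (intro allI impI)
      fix a b
      assume ab: "{a, b} \<in> edges G" "a \<in> (\<Union>t<Suc n. B' t)" "b \<in> (\<Union>t<Suc n. B' t)"
      \<comment> \<open>Neighbors of a vertex of \<open>K\<close> lie in \<open>K\<close> or in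
        \<open>\<sigma>\<close>; those in \<open>U \<union> bag\<close> all belong to the new
        bag.\<close>
      have *: "b \<in> bag" if "a \<in> K" "a \<in> bag" "{a, b} \<in> edges G" "b \<in> U \<union> bag" for a b
      proof (cases "b \<in> K")
        case True
        with that KU show ?thesis by auto
      next
        case False
        with that have "b \<in> \<sigma>" using edge_G_in[OF that(3)] by (auto simp: \<sigma>_def boundary_def verts_G)
        with node show ?thesis by auto
      qed
      show "\<exists>t<Suc n. a \<in> B' t \<and> b \<in> B' t"
      proof (cases "a \<in> U \<and> b \<in> U")
        case True
        with edges ab(1) obtain t where "t < n" "a \<in> B t" "b \<in> B t" by blast
        with old show ?thesis by (metis less_SucI)
      next
        case False
        then have "a \<in> bag \<and> b \<in> bag"
          using ab *[of a b] *[of b a] node(4) \<sigma>U unfolding U' by (auto simp: insert_commute)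
        with at_n show ?thesis by (intro exI[of _ n]) auto
      qed
    qed
  qed simp
  moreover have "extendable (Suc n) B' g'"
    unfolding extendable_def U' Let_def
  proof
    fix u assume u: "u \<in> V - (U \<union> bag)"
    define K' where "K' = component G (V - (U \<union> bag)) u"
    have eq: "V - (U \<union> bag) = (V - U) - bag" by auto
    show "\<exists>t<Suc n. boundary G (component G (V - (U \<union> bag)) u) \<subseteq> B' t \<and>
      card (boundary G (component G (V - (U \<union> bag)) u)) \<le> max_adhesion s k \<and>
      card (boundary G (component G (V - (U \<union> bag)) u) - g' t) \<le> 1"
    \<comment> \<open>Components outside \<open>K\<close> do not meet the bag and keep their node.
      Those inside \<open>K\<close> have their boundary in the new bag and are attached to node
      \<open>n\<close>.\<close>
    proof (cases "u \<in> K")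
      case False
      have "component G (V - U) u \<inter> K = {}"
      proof (rule ccontr)
        assume "component G (V - U) u \<inter> K \<noteq> {}"
        then obtain x where "x \<in> component G (V - U) u" "x \<in> K" by blast
        then have "component G (V - U) u = K" unfolding K_def by (metis component_eq)
        with False component_self[of u] show False by blast
      qed
      moreover have "component G (V - U) u \<subseteq> V - U" using u by (intro component_subset) auto
      ultimately have "component G (V - U) u \<inter> bag = {}" using node(4) \<sigma>U by blast
      from component_remove[OF this] have c: "component G (V - (U \<union> bag)) u = component G (V - U) u"
        unfolding eq .
      have "u \<in> V - U" using u by auto
      with ext obtain t where "t < n" "boundary G (component G (V - U) u) \<subseteq> B t"
        "card (boundary G (component G (V - U) u)) \<le> max_adhesion s k"
        "card (boundary G (component G (V - U) u) - g t) \<le> 1"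
        unfolding extendable_def U_def[symmetric] Let_def by blast
      then show ?thesis unfolding c using old[of t] by (intro exI[of _ t]) auto
    next
      case True
      have "K' \<subseteq> component G (V - U) u" unfolding K'_def by (rule component_mono) auto
      also have "\<dots> = K" using True unfolding K_def by (rule component_eq)
      finally have K'K: "K' \<subseteq> K" .
      have K'c: "K' \<subseteq> V - (U \<union> bag)" unfolding K'_def by (rule component_subset[OF u])
      have N: "boundary G K' \<subseteq> bag"
      proof
        fix y assume y: "y \<in> boundary G K'"
        have "y \<in> U \<union> bag" using boundary_component[OF u, of G] y
          by (auto simp: K'_def boundary_def verts_G)
        moreover have "y \<in> \<sigma>" if "y \<in> U"
          using y K'K that KU by (auto simp: \<sigma>_def boundary_def)
        ultimately show "y \<in> bag" using node by auto
      qed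
      have "card (boundary G K') \<le> max_adhesion s k \<and> card (boundary G K' - gd) \<le> 1"
      proof (intro new[rule_format])
        show "K' \<subseteq> K - bag" using K'K K'c by blast
        show "K' \<noteq> {}" using component_self[of u G "V - (U \<union> bag)"] by (auto simp: K'_def)
        show "(a, b) \<in> (adj G K')\<^sup>*" if "a \<in> K'" "b \<in> K'" for a b
          using that unfolding K'_def by (rule component_connected)
      qed (rule N)
      then show ?thesis using N at_n unfolding K'_def by (intro exI[of _ n]) auto
    qed
  qed
  moreover have "U \<subset> (\<Union>t<Suc n. B' t)" unfolding U' using vW node by blast
  ultimately show ?thesis unfolding U_def
    by - (rule exI[of _ p'], rule exI[of _ B'], rule exI[of _ g'], intro conjI)
qed

lemma ex_decomposition:
  "\<exists>n p B g. partial_decomposition n p B g \<and> V = (\<Union>t<n. B t)"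
proof -
  have *: "\<exists>n p B g. partial_decomposition n p B g \<and> V = (\<Union>t<n. B t)"
    if "partial_decomposition n p B g" "extendable n B g" for n p B g
    using that
  proof (induction "card (V - (\<Union>t<n. B t))" arbitrary: n p B g rule: less_induct)
    case less
    have sub: "(\<Union>t<n. B t) \<subseteq> V" if "partial_decomposition n p B g" for n p B g
      using that by (auto simp: partial_decomposition_def)
    show ?case
    proof (cases "V = (\<Union>t<n. B t)")
      case False
      with sub[OF less.prems(1)] obtain v where "v \<in> V - (\<Union>t<n. B t)" by blast
      from extend[OF less.prems this] obtain p' B' g' where
        e: "partial_decomposition (Suc n) p' B' g'" "extendable (Suc n) B' g'"
          "(\<Union>t<n. B t) \<subset> (\<Union>t<Suc n. B' t)" by (elim exE conjE) (rule that; assumption)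
      have "card (V - (\<Union>t<Suc n. B' t)) < card (V - (\<Union>t<n. B t))"
      proof (rule psubset_card_mono)
        from e(3) obtain x where "x \<in> (\<Union>t<Suc n. B' t)" "x \<notin> (\<Union>t<n. B t)" by blast
        moreover from this sub[OF e(1)] have "x \<in> V" by blast
        moreover have "V - (\<Union>t<Suc n. B' t) \<subseteq> V - (\<Union>t<n. B t)" using e(3) by (intro Diff_mono) auto
        ultimately show "V - (\<Union>t<Suc n. B' t) \<subset> V - (\<Union>t<n. B t)" by blast
      qed (use finV in simp)
      from less.hyps[OF this e(1,2)] show ?thesis .
    qed (use less in blast)
  qed
  \<comment> \<open>An empty root bag gives every component of the whole graph an empty boundary,
    and already suffices if there are no vertices.\<close>
  have "partial_decomposition 1 id (\<lambda>_. {}) (\<lambda>_. {})" by (auto simp: partial_decomposition_def)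
  moreover have "extendable 1 (\<lambda>_. {}) (\<lambda>_. {})"
    unfolding extendable_def Let_def
  proof
    fix v assume "v \<in> V - (\<Union>t<1::nat. {})"
    then have "boundary G (component G (V - {}) v) = {}"
      using boundary_component[of v "V - {}" G] by (auto simp: boundary_def verts_G)
    then show "\<exists>t<1::nat. boundary G (component G (V - (\<Union>t<1::nat. {})) v) \<subseteq> {} \<and>
      card (boundary G (component G (V - (\<Union>t<1::nat. {})) v)) \<le> max_adhesion s k \<and>
      card (boundary G (component G (V - (\<Union>t<1::nat. {})) v) - {}) \<le> 1"
      by (intro exI[of _ 0]) auto
  qed
  ultimately show ?thesis by (rule *)
qed

end

section \<open>Computable functions\<close>

definition computable :: "nat \<Rightarrow> (nat list \<Rightarrow> nat) \<Rightarrow> bool" where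
  "computable k f \<longleftrightarrow> (\<exists>p. \<forall>e. length e = k \<longrightarrow> computes p e (f e))"

definition decidable :: "nat \<Rightarrow> (nat list \<Rightarrow> bool) \<Rightarrow> bool" where
  "decidable k P \<longleftrightarrow> computable k (\<lambda>e. of_bool (P e))"

text \<open>
  In the rules below, the bound variables of sums and quantifiers are put in front of the argument
  list, so that variables are accessed by \<open>hd\<close> and \<open>tl\<close>.
\<close>

named_theorems comp_intros

lemma computable_cong:
  assumes "computable k g" "\<And>e. length e = k \<Longrightarrow> f e = g e"
  shows "computable k f"
  using assms by (auto simp: computable_def)

lemma computable_nth: "i < k \<Longrightarrow> computable k (\<lambda>e. e ! i)"
  unfolding computable_def by (intro exI[of _ "Proj i"]) (auto intro: computes.intros)

lemma computable_var:
  assumes "i < k"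
  shows "computable k (\<lambda>e. hd ((tl ^^ i) e))"
proof (rule computable_cong[OF computable_nth[OF assms]])
  fix e :: "nat list" assume "length e = k"
  moreover have "(tl ^^ i) e = drop i e" by (induction i) (auto simp: drop_Suc tl_drop)
  ultimately show "hd ((tl ^^ i) e) = e ! i" using assms by (simp add: hd_drop_conv_nth)
qed

lemma computable_vars [comp_intros]:
  "0 < k \<Longrightarrow> computable k (\<lambda>e. hd e)"
  "1 < k \<Longrightarrow> computable k (\<lambda>e. hd (tl e))"
  "2 < k \<Longrightarrow> computable k (\<lambda>e. hd (tl (tl e)))"
  "3 < k \<Longrightarrow> computable k (\<lambda>e. hd (tl (tl (tl e))))"
  "4 < k \<Longrightarrow> computable k (\<lambda>e. hd (tl (tl (tl (tl e)))))"
  "5 < k \<Longrightarrow> computable k (\<lambda>e. hd (tl (tl (tl (tl (tl e))))))"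
  "6 < k \<Longrightarrow> computable k (\<lambda>e. hd (tl (tl (tl (tl (tl (tl e)))))))"
  "7 < k \<Longrightarrow> computable k (\<lambda>e. hd (tl (tl (tl (tl (tl (tl (tl e))))))))"
  "8 < k \<Longrightarrow> computable k (\<lambda>e. hd (tl (tl (tl (tl (tl (tl (tl (tl e)))))))))"
  "9 < k \<Longrightarrow> computable k (\<lambda>e. hd (tl (tl (tl (tl (tl (tl (tl (tl (tl e))))))))))"
  using computable_var[of 0 k] computable_var[of 1 k] computable_var[of 2 k]
    computable_var[of 3 k] computable_var[of 4 k] computable_var[of 5 k]
    computable_var[of 6 k] computable_var[of 7 k] computable_var[of 8 k] computable_var[of 9 k]
  by (simp_all add: eval_nat_numeral)

lemma computable_const [comp_intros]: "computable k (\<lambda>e. c)"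
proof -
  have "\<exists>p. \<forall>e. computes p e c"
  proof (induction c)
    case 0
    show ?case by (intro exI[of _ Zero]) (auto intro: computes.intros)
  next
    case (Suc c)
    then obtain p where "\<forall>e. computes p e c" by blast
    then have "computes (Comp Succ [p]) e (Suc c)" for e
      by (intro computes.intros(4)[of e _ "[c]"] computes.intros(2)) auto
    then show ?case by blast
  qed
  then show ?thesis by (auto simp: computable_def)
qed

lemma computable_Comp:
  assumes F: "computable n F" "length gs = n" and gs: "\<forall>g\<in>set gs. computable k g"
  shows "computable k (\<lambda>e. F (map (\<lambda>g. g e) gs))"
proof -
  obtain q where q: "\<And>e. length e = n \<Longrightarrow> computes q e (F e)"
    using F by (auto simp: computable_def)
  have "\<forall>g\<in>set gs. \<exists>p. \<forall>e. length e = k \<longrightarrow> computes p e (g e)"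
    using gs by (simp add: computable_def)
  then obtain P where P: "\<forall>g\<in>set gs. \<forall>e. length e = k \<longrightarrow> computes (P g) e (g e)"
    by (auto dest!: bchoice)
  have "computes (Comp q (map P gs)) e (F (map (\<lambda>g. g e) gs))" if "length e = k" for e
    using that P F(2) by (intro computes.intros(4)[OF _ q]) (auto simp: list_all2_conv_all_nth)
  then show ?thesis by (auto simp: computable_def)
qed

lemma computable_Suc [comp_intros]:
  assumes "computable k f"
  shows "computable k (\<lambda>e. Suc (f e))"
proof -
  have "computable 1 (\<lambda>e. Suc (hd e))"
    unfolding computable_def
    by (intro exI[of _ Succ]) (auto simp: length_Suc_conv intro: computes.intros)
  from computable_Comp[OF this, of "[f]" k] assms show ?thesis by simp
qed

lemma computable_comp2:
  assumes "computable 2 (\<lambda>e. F (hd e) (hd (tl e)))" "computable k f" "computable k g"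
  shows "computable k (\<lambda>e. F (f e) (g e))"
  using computable_Comp[OF assms(1), of "[f, g]" k] assms(2,3) by simp

lemma computable_rec:
  assumes "computable k f" "computable (Suc (Suc k)) g"
  shows "computable (Suc k) (\<lambda>e. rec_nat (f (tl e)) (\<lambda>n y. g (n # y # tl e)) (hd e))"
proof -
  obtain p q where p: "\<And>e. length e = k \<Longrightarrow> computes p e (f e)"
    and q: "\<And>e. length e = Suc (Suc k) \<Longrightarrow> computes q e (g e)"
    using assms by (auto simp: computable_def)
  have "computes (PRec p q) (n # e) (rec_nat (f e) (\<lambda>n y. g (n # y # e)) n)"
    if "length e = k" for n e
  proof (induction n)
    case (Suc n)
    then show ?case using that by (auto intro!: computes.intros(6) q)
  qed (use that in \<open>auto intro: computes.intros p\<close>)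
  then show ?thesis unfolding computable_def
    by (intro exI[of _ "PRec p q"]) (auto simp: length_Suc_conv)
qed

section \<open>Arithmetic and bounded sums\<close>

lemma computable_add [comp_intros]:
  assumes "computable k f" "computable k g"
  shows "computable k (\<lambda>e. f e + g e)"
proof (rule computable_comp2[OF _ assms])
  have *: "rec_nat x (\<lambda>n y. Suc y) n = n + x" for x n :: nat by (induction n) auto
  have "computable 1 (\<lambda>e. hd e)" "computable (Suc (Suc 1)) (\<lambda>e. Suc (hd (tl e)))"
    by (intro comp_intros; simp)+
  from computable_rec[OF this] show "computable 2 (\<lambda>e. hd e + hd (tl e))"
    by (simp add: * numeral_2_eq_2)
qed

lemma computable_pow2 [comp_intros]:
  assumes "computable k f"
  shows "computable k (\<lambda>e. 2 ^ f e)"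
proof -
  have *: "rec_nat 1 (\<lambda>n y. y + y) n = (2::nat) ^ n" for n by (induction n) auto
  have "computable 0 (\<lambda>e. 1)" "computable (Suc (Suc 0)) (\<lambda>e. hd (tl e) + hd (tl e))"
    by (intro comp_intros; simp)+
  from computable_rec[OF this] have "computable 1 (\<lambda>e. 2 ^ hd e)" by (simp add: *[simplified])
  from computable_Comp[OF this, of "[f]" k] assms show ?thesis by simp
qed

text \<open>The predecessor is the recursion that returns its counter, and iterating it gives
  truncated subtraction.\<close>

lemma computable_diff [comp_intros]:
  assumes "computable k f" "computable k g"
  shows "computable k (\<lambda>e. f e - g e)"
proof -
  have *: "rec_nat 0 (\<lambda>n y. n) n = n - 1" for n :: nat by (cases n) auto
  have "computable 0 (\<lambda>e. 0)" "computable (Suc (Suc 0)) (\<lambda>e. hd e)"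
    by (intro comp_intros; simp)+
  from computable_rec[OF this] have pred: "computable 1 (\<lambda>e. hd e - 1)" by (simp add: *[simplified])
  have "computable (Suc (Suc 1)) (\<lambda>e. hd (tl e))" by (intro comp_intros) simp
  with computable_Comp[OF pred, of "[\<lambda>e. hd (tl e)]" "Suc (Suc 1)"]
  have step: "computable (Suc (Suc 1)) (\<lambda>e. hd (tl e) - 1)" by simp
  have "computable 1 (\<lambda>e. hd e)" by (intro comp_intros) simp
  have **: "rec_nat x (\<lambda>n y. y - 1) n = x - n" for x n :: nat by (induction n) auto
  from computable_rec[OF \<open>computable 1 (\<lambda>e. hd e)\<close> step]
  have "computable 2 (\<lambda>e. hd (tl e) - hd e)" by (simp add: **[simplified] numeral_2_eq_2)
  from computable_comp2[OF this assms(2,1)] show ?thesis .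
qed

text \<open>Products, triangular numbers, bounded quantifiers, table lookup and cardinalities are
  all expressed by bounded sums.\<close>

lemma computable_sum [comp_intros]:
  assumes b: "computable k b" and F: "computable (Suc k) (\<lambda>e. F (tl e) (hd e))"
  shows "computable k (\<lambda>e. \<Sum>y<b e. F e y)"
proof -
  \<comment> \<open>In a recursion step the counter and the accumulated value precede the
    parameters; projections drop the accumulated value.\<close>
  have F': "computable (Suc (Suc k)) (\<lambda>e. F (tl (tl e)) (hd e))"
  proof (rule computable_cong)
    show "computable (Suc (Suc k)) (\<lambda>e. (\<lambda>e. F (tl e) (hd e)) (map (\<lambda>g. g e)
      ((\<lambda>e. e ! 0) # map (\<lambda>i e. e ! (i + 2)) [0..<k])))"
      by (rule computable_Comp[OF F]) (auto intro!: computable_nth)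
    fix e :: "nat list" assume e: "length e = Suc (Suc k)"
    have "map (\<lambda>i. e ! (i + 2)) [0..<k] = tl (tl e)"
      using e by (intro nth_equalityI) (auto simp: nth_tl)
    with e show "F (tl (tl e)) (hd e) = (\<lambda>e. F (tl e) (hd e)) (map (\<lambda>g. g e)
      ((\<lambda>e. e ! 0) # map (\<lambda>i e. e ! (i + 2)) [0..<k]))"
      by (cases e) (auto simp: comp_def)
  qed
  have *: "rec_nat 0 (\<lambda>n y. y + f n) n = (\<Sum>i<n. f i)" for f :: "nat \<Rightarrow> nat" and n
    by (induction n) auto
  have "computable k (\<lambda>e. 0)" "computable (Suc (Suc k)) (\<lambda>e. hd (tl e) + F (tl (tl e)) (hd e))"
    using F' by (intro comp_intros; simp)+
  from computable_rec[OF this] have S: "computable (Suc k) (\<lambda>e. \<Sum>y<hd e. F (tl e) y)"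
    by (simp add: *)
  show ?thesis
  proof (rule computable_cong)
    show "computable k (\<lambda>e. (\<lambda>e. \<Sum>y<hd e. F (tl e) y) (map (\<lambda>g. g e)
      (b # map (\<lambda>i e. e ! i) [0..<k])))"
      using b by (intro computable_Comp[OF S]) (auto intro!: computable_nth)
    fix e :: "nat list" assume "length e = k"
    then have "map (\<lambda>i. e ! i) [0..<k] = e" by (auto intro: map_nth)
    then show "(\<Sum>y<b e. F e y) = (\<lambda>e. \<Sum>y<hd e. F (tl e) y) (map (\<lambda>g. g e)
      (b # map (\<lambda>i e. e ! i) [0..<k]))"
      by (auto simp: comp_def)
  qed
qed

lemma computable_mult [comp_intros]:
  assumes "computable k f" "computable k g"
  shows "computable k (\<lambda>e. f e * g e)"
proof (rule computable_comp2[OF _ assms])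
  have "computable 2 (\<lambda>e. \<Sum>_<hd e. hd (tl e))" by (intro comp_intros; simp)
  then show "computable 2 (\<lambda>e. hd e * hd (tl e))" by simp
qed

section \<open>Decidable predicates\<close>

lemma computable_of_bool [comp_intros]: "decidable k P \<Longrightarrow> computable k (\<lambda>e. of_bool (P e))"
  by (simp add: decidable_def)

lemma decidable_less [comp_intros]:
  assumes "computable k f" "computable k g"
  shows "decidable k (\<lambda>e. f e < g e)"
proof -
  have "computable k (\<lambda>e. 1 - (Suc (f e) - g e))" using assms by (intro comp_intros)
  then show ?thesis unfolding decidable_def by (rule computable_cong) auto
qed

lemma decidable_not [comp_intros]:
  assumes "decidable k P"
  shows "decidable k (\<lambda>e. \<not> P e)"
proof -
  have "computable k (\<lambda>e. 1 - of_bool (P e))" using assms by (intro comp_intros)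
  then show ?thesis unfolding decidable_def by (rule computable_cong) auto
qed

lemma decidable_conj [comp_intros]:
  assumes "decidable k P" "decidable k Q"
  shows "decidable k (\<lambda>e. P e \<and> Q e)"
proof -
  have "computable k (\<lambda>e. of_bool (P e) * of_bool (Q e))" using assms by (intro comp_intros)
  then show ?thesis unfolding decidable_def by (rule computable_cong) auto
qed

lemma decidable_disj [comp_intros]:
  assumes "decidable k P" "decidable k Q"
  shows "decidable k (\<lambda>e. P e \<or> Q e)"
proof -
  have "decidable k (\<lambda>e. \<not> (\<not> P e \<and> \<not> Q e))" using assms by (intro comp_intros)
  then show ?thesis by simp
qed

lemma decidable_imp [comp_intros]:
  assumes "decidable k P" "decidable k Q"
  shows "decidable k (\<lambda>e. P e \<longrightarrow> Q e)"
  using decidable_disj[OF decidable_not[OF assms(1)] assms(2)] by (simp only: imp_conv_disj)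

lemma decidable_le [comp_intros]:
  assumes "computable k f" "computable k g"
  shows "decidable k (\<lambda>e. f e \<le> g e)"
  using decidable_not[OF decidable_less[OF assms(2,1)]] by (simp add: not_less)

lemma decidable_eq [comp_intros]:
  assumes "computable k f" "computable k g"
  shows "decidable k (\<lambda>e. f e = g e)"
  using decidable_conj[OF decidable_le[OF assms] decidable_le[OF assms(2,1)]]
  by (simp add: order_eq_iff)

lemma decidable_ex [comp_intros]:
  assumes "computable k b" "decidable (Suc k) (\<lambda>e. P (tl e) (hd e))"
  shows "decidable k (\<lambda>e. \<exists>y<b e. P e y)"
proof -
  have "decidable k (\<lambda>e. (0::nat) < (\<Sum>y<b e. of_bool (P e y)))"
    using assms by (intro comp_intros)
  moreover have "(0::nat) < (\<Sum>y<b e. of_bool (P e y)) \<longleftrightarrow> (\<exists>y<b e. P e y)" for e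
    by (auto simp: card_gt_0_iff)
  ultimately show ?thesis by (simp only:)
qed

lemma decidable_all [comp_intros]:
  assumes "computable k b" "decidable (Suc k) (\<lambda>e. P (tl e) (hd e))"
  shows "decidable k (\<lambda>e. \<forall>y<b e. P e y)"
proof -
  have "decidable k (\<lambda>e. \<not> (\<exists>y<b e. \<not> P e y))"
    using assms by (intro comp_intros)
  then show ?thesis by simp
qed

lemma computable_prod_encode [comp_intros]:
  assumes "computable k f" "computable k g"
  shows "computable k (\<lambda>e. prod_encode (f e, g e))"
proof -
  have *: "triangle n = (\<Sum>y<Suc n. y)" for n by (induction n) auto
  have "computable k (\<lambda>e. (\<Sum>y<Suc (f e + g e). y) + f e)"
    using assms by (intro comp_intros) auto
  then show ?thesis by (simp add: prod_encode_def *)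
qed

text \<open>Membership says that \<open>n div 2 ^ a\<close> is odd; a bounded search for quotient
  and remainder takes the place of division.\<close>

lemma decidable_set_decode [comp_intros]:
  assumes "computable k f" "computable k g"
  shows "decidable k (\<lambda>e. f e \<in> set_decode (g e))"
proof -
  have *: "a \<in> set_decode n \<longleftrightarrow> (\<exists>q<Suc n. \<exists>r<2 ^ a. n = (2 * q + 1) * 2 ^ a + r)" for a n :: nat
  proof
    assume "a \<in> set_decode n"
    then obtain q where q: "n div 2 ^ a = 2 * q + 1" by (auto simp: set_decode_def elim: oddE)
    have "n = (2 * q + 1) * 2 ^ a + n mod 2 ^ a" unfolding q[symmetric] by (rule div_mult_mod_eq[symmetric])
    moreover have "2 * q + 1 \<le> n" unfolding q[symmetric] by simp
    ultimately show "\<exists>q<Suc n. \<exists>r<2 ^ a. n = (2 * q + 1) * 2 ^ a + r"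
      by (intro exI[of _ q] conjI exI[of _ "n mod 2 ^ a"]) auto
  next
    assume "\<exists>q<Suc n. \<exists>r<2 ^ a. n = (2 * q + 1) * 2 ^ a + r"
    then obtain q r where "r < 2 ^ a" "n = (2 * q + 1) * 2 ^ a + r" by blast
    then have "n div 2 ^ a = 2 * q + 1" by (intro div_nat_eqI) (auto simp: algebra_simps)
    then show "a \<in> set_decode n" by (simp add: set_decode_def)
  qed
  have "decidable 2 (\<lambda>e. \<exists>q<Suc (hd (tl e)). \<exists>r<2 ^ hd e. hd (tl e) = (2 * q + 1) * 2 ^ hd e + r)"
    by (intro comp_intros; simp)
  then have "computable 2 (\<lambda>e. of_bool (hd e \<in> set_decode (hd (tl e))))"
    by (simp only: * decidable_def)
  from computable_comp2[OF this assms] show ?thesis by (simp only: decidable_def)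
qed

text \<open>\<open>Mu\<close> stops at the first zero, so it is applied to the negated predicate.
  Halting is asserted only where a witness exists.\<close>

lemma ex_least_program:
  assumes "decidable (Suc k) (\<lambda>e. P (tl e) (hd e))"
  shows "\<exists>p. \<forall>e. length e = k \<longrightarrow> (\<exists>m. P e m) \<longrightarrow> computes p e (LEAST m. P e m)"
proof -
  from decidable_not[OF assms] obtain p where
    p: "\<And>e. length e = Suc k \<Longrightarrow> computes p e (of_bool (\<not> P (tl e) (hd e)))"
    by (auto simp: decidable_def computable_def)
  have "computes (Mu p) e (LEAST m. P e m)" if "length e = k" "\<exists>m. P e m" for e
  proof (rule computes.intros(7))
    have "P e (LEAST m. P e m)" using that(2) by (rule LeastI_ex)
    with p[of "(LEAST m. P e m) # e"] that show "computes p ((LEAST m. P e m) # e) 0" by simp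
    show "\<forall>m<LEAST m. P e m. \<exists>y. computes p (m # e) (Suc y)"
    proof (intro allI impI)
      fix m assume "m < (LEAST m. P e m)"
      then have "\<not> P e m" by (rule not_less_Least)
      with p[of "m # e"] that have "computes p (m # e) (Suc 0)" by simp
      then show "\<exists>y. computes p (m # e) (Suc y)" by blast
    qed
  qed
  then show ?thesis by blast
qed

section \<open>Guarded decompositions with ordered nodes\<close>

text \<open>The final clause covers all edges of \<open>bullet H col\<close> and, with
  \<open>u = v\<close>, every vertex. One bound \<open>b\<close> serves for guards and
  colors.\<close>

definition ordered_guarded :: "'a ugraph \<Rightarrow> ('a \<Rightarrow> 'c) \<Rightarrow> nat \<Rightarrow> nat \<Rightarrow> (nat \<Rightarrow> nat) \<Rightarrow>
    (nat \<Rightarrow> 'a set) \<Rightarrow> (nat \<Rightarrow> 'a set) \<Rightarrow> bool" where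
  "ordered_guarded H col b n p B g \<longleftrightarrow> 0 < n \<and>
     (\<forall>t<n. B t \<subseteq> verts H \<and> g t \<subseteq> B t \<and>
        (\<forall>u\<in>B t. \<forall>v\<in>B t. {u, v} \<in> edges H \<longrightarrow> u \<in> g t \<or> v \<in> g t) \<and>
        card (g t) \<le> b \<and> card (col ` B t) \<le> b \<and>
        (0 < t \<longrightarrow> p t < t \<and> B t \<inter> B (p t) \<subseteq> g t \<and> card (B t \<inter> B (p t) - g (p t)) \<le> 1) \<and>
        (\<forall>s<t. B t \<inter> B s \<subseteq> B (p t))) \<and>
     (\<forall>u\<in>verts H. \<forall>v\<in>verts H. {u, v} \<in> edges H \<or> col u = col v \<longrightarrow> (\<exists>t<n. u \<in> B t \<and> v \<in> B t))"

text \<open>Needed when arbitrary functions are replaced by finite tables, which agree with them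
  only at nodes below \<open>n\<close>.\<close>

lemma ordered_guarded_cong:
  assumes "ordered_guarded H col b n p B g"
    and "\<And>t. t < n \<Longrightarrow> p' t = p t" "\<And>t. t < n \<Longrightarrow> B' t = B t" "\<And>t. t < n \<Longrightarrow> g' t = g t"
  shows "ordered_guarded H col b n p' B' g'"
proof -
  have p: "\<forall>t<n. 0 < t \<longrightarrow> p t < t" using assms(1) by (simp add: ordered_guarded_def)
  have "B' (p' t) = B (p t) \<and> g' (p' t) = g (p t)" if "t < n" "0 < t" for t
    using assms(2-) p that by (metis less_trans)
  moreover have "B' s = B s" if "s < t" "t < n" for s t using that assms(3) by auto
  moreover have "(\<exists>t<n. u \<in> B' t \<and> v \<in> B' t) \<longleftrightarrow> (\<exists>t<n. u \<in> B t \<and> v \<in> B t)" for u v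
    using assms(3) by auto
  ultimately show ?thesis using assms unfolding ordered_guarded_def by auto
qed

lemma ordered_guarded_decomposition:
  assumes H: "simple_graph H" and og: "ordered_guarded H col b n p B g"
  shows "guarded_cutvertex_decomposition H col (ordered_tree n p) 0 B g"
    and "guard_size (ordered_tree n p) g \<le> b"
    and "\<forall>t\<in>verts (ordered_tree n p). card (col ` B t) \<le> b"
proof -
  let ?T = "ordered_tree n p"
  have vT: "verts ?T = {..<n}" by (simp add: ordered_tree_def)
  have vG: "verts (bullet H col) = verts H" by (simp add: bullet_def make_cliques_def)
  have n: "0 < n" and p: "\<And>t. 0 < t \<Longrightarrow> t < n \<Longrightarrow> p t < t"
    and cov: "\<And>u v. u \<in> verts H \<Longrightarrow> v \<in> verts H \<Longrightarrow> {u, v} \<in> edges H \<or> col u = col v \<Longrightarrow>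
      \<exists>t<n. u \<in> B t \<and> v \<in> B t"
    and sub: "\<And>t. t < n \<Longrightarrow> B t \<subseteq> verts H" "\<And>t. t < n \<Longrightarrow> g t \<subseteq> B t"
    and cover: "\<And>t u v. t < n \<Longrightarrow> u \<in> B t \<Longrightarrow> v \<in> B t \<Longrightarrow> {u, v} \<in> edges H \<Longrightarrow> u \<in> g t \<or> v \<in> g t"
    and adh: "\<And>t. 0 < t \<Longrightarrow> t < n \<Longrightarrow> B t \<inter> B (p t) \<subseteq> g t"
      "\<And>t. 0 < t \<Longrightarrow> t < n \<Longrightarrow> card (B t \<inter> B (p t) - g (p t)) \<le> 1"
    and top: "\<And>s t. t < n \<Longrightarrow> s < t \<Longrightarrow> B t \<inter> B s \<subseteq> B (p t)"
    and bounds: "\<And>t. t < n \<Longrightarrow> card (g t) \<le> b" "\<And>t. t < n \<Longrightarrow> card (col ` B t) \<le> b"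
    using og by (auto simp: ordered_guarded_def)
  have edge: "\<exists>u v. e = {u, v} \<and> u \<in> verts H \<and> v \<in> verts H" if "e \<in> edges H" for e
  proof -
    from H that have "e \<subseteq> verts H" "card e = 2" by (auto simp: simple_graph_def)
    then show ?thesis by (auto simp: card_2_iff)
  qed
  have "ordered_decomposition (bullet H col) n p B"
    unfolding ordered_decomposition_def vG
  proof (intro conjI allI impI ballI)
    show "\<exists>t<n. v \<in> B t" if "v \<in> verts H" for v using cov[of v v] that by auto
    fix e assume "e \<in> edges (bullet H col)"
    then obtain u v where e: "e = {u, v}" "u \<in> verts H" "v \<in> verts H"
      "{u, v} \<in> edges H \<or> col u = col v"
    proof -
      assume that: "\<And>u v. e = {u, v} \<Longrightarrow> u \<in> verts H \<Longrightarrow> v \<in> verts H \<Longrightarrow>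
        {u, v} \<in> edges H \<or> col u = col v \<Longrightarrow> thesis"
      show thesis
      proof (cases "e \<in> edges H")
        case True
        with edge[OF this] that show thesis by blast
      next
        case False
        with \<open>e \<in> edges (bullet H col)\<close> that show thesis
          by (auto simp: bullet_def make_cliques_def color_class_def)
      qed
    qed
    with cov[of u v] show "\<exists>t<n. e \<subseteq> B t" by auto
  qed (use n p sub top in auto)
  then have td: "tree_decomposition (bullet H col) ?T B" by (rule ordered_tree_decomposition)
  have par: "parent ?T 0 t = p t" if "0 < t" "t < n" for t
    using parent_ordered_tree[OF p that] .
  have adhesion: "adhesion ?T 0 B t = (if t = 0 then {} else B t \<inter> B (p t))" if "t < n" for t
    using par[of t] that by (auto simp: adhesion_def)
  have vc: "vertex_cover (induced H (B t)) (g t)" if "t < n" for t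
    unfolding vertex_cover_def
  proof (intro conjI ballI)
    show "g t \<subseteq> verts (induced H (B t))" using sub that by (simp add: induced_def)
    fix e assume "e \<in> edges (induced H (B t))"
    then have "e \<in> edges H" "e \<subseteq> B t" by (auto simp: induced_def)
    with edge obtain u v where "e = {u, v}" by blast
    with cover[OF that, of u v] \<open>e \<in> edges H\<close> \<open>e \<subseteq> B t\<close> show "e \<inter> g t \<noteq> {}" by auto
  qed
  have child: "card (adhesion ?T 0 B t' - g t) \<le> 1" if "is_child ?T 0 t' t" for t t'
  proof -
    from that par[of t'] have t': "0 < t'" "t' < n" "p t' = t" by (auto simp: is_child_def vT)
    then show ?thesis using adh(2)[of t'] adhesion[of t'] by auto
  qed
  show "guarded_cutvertex_decomposition H col ?T 0 B g"
    unfolding guarded_cutvertex_decomposition_def vT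
    using td n adh(1) sub(2) vc child by (auto simp: adhesion)
  show "guard_size ?T g \<le> b" unfolding guard_size_def vT
    using n bounds by (subst Max_le_iff) auto
  show "\<forall>t\<in>verts ?T. card (col ` B t) \<le> b" using bounds by (simp add: vT)
qed

lemma ex_ordered_guarded:
  fixes H :: "'a ugraph" and col :: "'a \<Rightarrow> 'c"
  assumes H: "simple_graph H" and w: "1 \<le> w" "treewidth (hat H col) \<le> w"
    and flower: "\<forall>i\<in>colors H col. \<nexists>P. is_flower H col c i P"
  shows "\<exists>n p B g. ordered_guarded H col (24 * ((c + w) * w)) n p B g"
proof -
  have fin: "finite (verts H)" using H by (simp add: simple_graph_def)
  have "\<exists>S. S \<subseteq> verts H \<and> card S \<le> 4 * c \<and>
      (\<forall>a\<in>color_class H col i - S. \<forall>b\<in>color_class H col i - S. a \<noteq> b \<longrightarrow>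
        (a, b) \<notin> (adj (bullet_except H col i) (verts H - S))\<^sup>*)" if "i \<in> colors H col" for i
  proof -
    have v: "verts (bullet_except H col i) = verts H"
      by (simp add: bullet_except_def make_cliques_def)
    have "\<nexists>P. packing (bullet_except H col i) (color_class H col i) (verts H) P \<and> card P = c"
      using flower that unfolding packing_def is_flower_def by blast
    with ex_hitting_set[of "bullet_except H col i" "color_class H col i" c] fin show ?thesis
      unfolding v by (auto simp: color_class_def)
  qed
  then obtain S where S: "\<And>i. i \<in> colors H col \<Longrightarrow> S i \<subseteq> verts H \<and> card (S i) \<le> 4 * c \<and>
      (\<forall>a\<in>color_class H col i - S i. \<forall>b\<in>color_class H col i - S i. a \<noteq> b \<longrightarrow>
        (a, b) \<notin> (adj (bullet_except H col i) (verts H - S i))\<^sup>*)" by metis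
  have vhat: "verts (hat H col) = colors H col" by (simp add: hat_def)
  have "\<forall>e\<in>edges (hat H col). e \<subseteq> verts (hat H col)"
    by (auto simp: hat_def colors_def color_class_def)
  moreover have finc: "finite (colors H col)" using fin by (simp add: colors_def)
  ultimately obtain n p B where od: "ordered_decomposition (hat H col) n p B"
    "\<forall>t<n. card (B t) \<le> Suc w"
    using ordered_decomposition_of_treewidth[of "hat H col" w] w(2) vhat by auto
  interpret separated_coloring H col S "4 * c" "Suc w"
  proof
    fix \<sigma> assume \<sigma>: "\<sigma> \<subseteq> verts H"
    have "finite \<sigma>" using \<sigma> fin by (rule finite_subset)
    moreover have "col ` \<sigma> \<subseteq> verts (hat H col)" using \<sigma> by (auto simp: vhat colors_def)
    ultimately obtain t where t: "t < n" "\<forall>D. D \<inter> B t = {} \<longrightarrow>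
      (\<forall>a\<in>D. \<forall>b\<in>D. (a, b) \<in> (adj (hat H col) (colors H col - B t))\<^sup>*) \<longrightarrow>
        2 * card {y \<in> \<sigma>. col y \<in> D} \<le> card \<sigma>"
      using balanced_separator[OF od(1), of \<sigma> col] unfolding vhat by blast
    have "B t \<subseteq> colors H col" using od(1) t(1) by (auto simp: ordered_decomposition_def vhat)
    with t od(2) show "\<exists>X\<subseteq>colors H col. card X \<le> Suc w \<and> (\<forall>D. D \<inter> X = {} \<longrightarrow>
      (\<forall>a\<in>D. \<forall>b\<in>D. (a, b) \<in> (adj (hat H col) (colors H col - X))\<^sup>*) \<longrightarrow>
        2 * card {y \<in> \<sigma>. col y \<in> D} \<le> card \<sigma>)" by blast
  qed (use H S in blast)+
  obtain n p B g where pd: "partial_decomposition n p B g" "verts H = (\<Union>t<n. B t)"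
    using ex_decomposition by blast
  \<comment> \<open>By \<open>w + 1 \<le> 2 * w\<close>, the terms containing \<open>c\<close> sum
    to \<open>12 * c * (w + 1) \<le> 24 * c * w\<close>, which determines the constant. The rest is
    \<open>w * w + 5 * w + 7\<close>, well below \<open>24 * w * w\<close>.\<close>
  have "guard_bound + Suc w \<le> 24 * ((c + w) * w)"
  proof -
    from w(1) obtain d where "w = Suc d" by (cases w) auto
    then show ?thesis unfolding guard_bound_def max_adhesion_def
      by (simp add: algebra_simps)
  qed
  then have bound: "x \<le> 24 * ((c + w) * w)" if "x \<le> guard_bound \<or> x \<le> guard_bound + Suc w" for x
    using that by linarith
  have "\<exists>t<n. u \<in> B t \<and> v \<in> B t"
    if uv: "u \<in> verts H" "v \<in> verts H" "{u, v} \<in> edges H \<or> col u = col v" for u v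
  proof (cases "u = v")
    case True
    with uv pd(2) show ?thesis by auto
  next
    case False
    with uv have "{u, v} \<in> edges G" by (simp add: edge_G_iff)
    with pd uv show ?thesis unfolding partial_decomposition_def by simp
  qed
  then have "ordered_guarded H col (24 * ((c + w) * w)) n p B g"
    using pd(1) bound unfolding partial_decomposition_def ordered_guarded_def by auto
  then show ?thesis by blast
qed

section \<open>Checking and encoding decompositions\<close>

text \<open>Table lookup as a sum over all second components paired with \<open>x\<close>. It is
  total on arbitrary numbers, and for the code of a function only one summand survives. Values are
  smaller than the code, so the bound \<open>F\<close> suffices.\<close>

definition app :: "nat \<Rightarrow> nat \<Rightarrow> nat" where
  "app F x = (\<Sum>y<F. of_bool (prod_encode (x, y) \<in> set_decode F) * y)"

text \<open>A set bit \<open>v\<close> forces \<open>2 ^ v \<le> n\<close>. This is what turns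
  quantifiers over encoded sets into bounded ones.\<close>

lemma set_decode_less: "v \<in> set_decode n \<Longrightarrow> v < n"
proof -
  assume "v \<in> set_decode n"
  then have "n div 2 ^ v \<noteq> 0" by (auto simp: set_decode_def intro: ccontr)
  then have "2 ^ v \<le> n" by (metis div_less not_le)
  then show "v < n" using less_exp[of v] by linarith
qed

lemma app_encode_map:
  assumes "finite A" "x \<in> A"
  shows "app (encode_map A f) x = f x"
proof -
  let ?F = "encode_map A f"
  have F: "set_decode ?F = (\<lambda>x. prod_encode (x, f x)) ` A"
    using assms by (simp add: encode_map_def)
  then have "prod_encode (x, y) \<in> set_decode ?F \<longleftrightarrow> y = f x" for y
    using assms by (auto simp: image_iff)
  then have "app ?F x = (\<Sum>y<?F. if y = f x then f x else 0)"
    unfolding app_def by (intro sum.cong) auto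
  moreover have "prod_encode (x, f x) \<in> set_decode ?F" using F assms by auto
  from set_decode_less[OF this] have "f x < ?F"
    using le_prod_encode_2[of "f x" x] by linarith
  ultimately show ?thesis by simp
qed

lemma computable_app [comp_intros]:
  assumes "computable k f" "computable k g"
  shows "computable k (\<lambda>e. app (f e) (g e))"
proof (rule computable_comp2[OF _ assms])
  show "computable 2 (\<lambda>e. app (hd e) (hd (tl e)))"
    unfolding app_def by (intro comp_intros; simp)
qed

text \<open>This is \<open>ordered_guarded\<close> on codes. Quantifiers range up to the code of a
  set, cardinalities become counting sums, and "at most one element" becomes uniqueness.\<close>

definition check :: "nat \<Rightarrow> nat \<Rightarrow> nat \<Rightarrow> nat \<Rightarrow> nat \<Rightarrow> nat \<Rightarrow> nat \<Rightarrow> nat \<Rightarrow> bool" where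
  "check vs es cs b n P B g \<longleftrightarrow> 0 < n \<and>
     (\<forall>t<n. (\<forall>v<app B t. v \<in> set_decode (app B t) \<longrightarrow> v \<in> set_decode vs) \<and>
        (\<forall>v<app g t. v \<in> set_decode (app g t) \<longrightarrow> v \<in> set_decode (app B t)) \<and>
        (\<forall>u<vs. \<forall>v<vs. u \<in> set_decode (app B t) \<and> v \<in> set_decode (app B t) \<and>
          prod_encode (u, v) \<in> set_decode es \<longrightarrow>
          u \<in> set_decode (app g t) \<or> v \<in> set_decode (app g t)) \<and>
        (\<Sum>v<vs. of_bool (v \<in> set_decode (app g t))) \<le> b \<and>
        (\<Sum>j<cs. of_bool (\<exists>v<vs. v \<in> set_decode (app B t) \<and> app cs v = j)) \<le> b \<and>
        (0 < t \<longrightarrow> app P t < t \<and>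
          (\<forall>v<vs. v \<in> set_decode (app B t) \<and> v \<in> set_decode (app B (app P t)) \<longrightarrow>
            v \<in> set_decode (app g t)) \<and>
          (\<forall>u<vs. \<forall>v<vs. (u \<in> set_decode (app B t) \<and> u \<in> set_decode (app B (app P t)) \<and>
              u \<notin> set_decode (app g (app P t))) \<and>
            (v \<in> set_decode (app B t) \<and> v \<in> set_decode (app B (app P t)) \<and>
              v \<notin> set_decode (app g (app P t))) \<longrightarrow> u = v)) \<and>
        (\<forall>s<t. \<forall>v<vs. v \<in> set_decode (app B t) \<and> v \<in> set_decode (app B s) \<longrightarrow>
          v \<in> set_decode (app B (app P t)))) \<and>
     (\<forall>u<vs. \<forall>v<vs. u \<in> set_decode vs \<and> v \<in> set_decode vs \<and>
        (prod_encode (u, v) \<in> set_decode es \<or> app cs u = app cs v) \<longrightarrow>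
        (\<exists>t<n. u \<in> set_decode (app B t) \<and> v \<in> set_decode (app B t)))"

lemma check_iff:
  assumes H: "simple_graph H"
  shows "check (set_encode (verts H)) (set_encode {prod_encode (u, v) | u v. {u, v} \<in> edges H})
      (encode_map (verts H) col) b n P B g \<longleftrightarrow>
    ordered_guarded H col b n (app P) (\<lambda>t. set_decode (app B t)) (\<lambda>t. set_decode (app g t))"
proof -
  define vs es cs where "vs = set_encode (verts H)"
    and "es = set_encode {prod_encode (u, v) | u v. {u, v} \<in> edges H}"
    and "cs = encode_map (verts H) col"
  have fin: "finite (verts H)" using H by (simp add: simple_graph_def)
  have V: "set_decode vs = verts H" using fin by (simp add: vs_def)
  have "{u, v} \<in> edges H \<Longrightarrow> u \<in> verts H \<and> v \<in> verts H" for u v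
    using H by (auto simp: simple_graph_def)
  then have "{prod_encode (u, v) | u v. {u, v} \<in> edges H} \<subseteq> prod_encode ` (verts H \<times> verts H)"
    by auto
  then have "finite {prod_encode (u, v) | u v. {u, v} \<in> edges H}"
    by (rule finite_subset) (use fin in auto)
  then have E: "prod_encode (u, v) \<in> set_decode es \<longleftrightarrow> {u, v} \<in> edges H" for u v
    by (auto simp: es_def)
  have less: "v < vs" if "v \<in> verts H" for v using that set_decode_less V by auto
  have C: "app cs v = col v" if "v \<in> verts H" for v
    using app_encode_map[OF fin that] by (simp add: cs_def)
  have Cless: "col v < cs" if "v \<in> verts H" for v
  proof -
    have "prod_encode (v, col v) \<in> set_decode cs" using fin that by (simp add: cs_def encode_map_def)
    then show ?thesis using set_decode_less le_prod_encode_2[of "col v" v] by fastforce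
  qed
  have all: "(\<forall>v<m. v \<in> set_decode m \<longrightarrow> Q v) \<longleftrightarrow> (\<forall>v\<in>set_decode m. Q v)" for m Q
    using set_decode_less by blast
  let ?B = "\<lambda>t. set_decode (app B t)" and ?g = "\<lambda>t. set_decode (app g t)"
  have node: "((\<forall>u<vs. \<forall>v<vs. u \<in> ?B t \<and> v \<in> ?B t \<and> prod_encode (u, v) \<in> set_decode es \<longrightarrow>
          u \<in> ?g t \<or> v \<in> ?g t) \<longleftrightarrow> (\<forall>u\<in>?B t. \<forall>v\<in>?B t. {u, v} \<in> edges H \<longrightarrow> u \<in> ?g t \<or> v \<in> ?g t))"
      "(\<Sum>v<vs. of_bool (v \<in> ?g t)) = card (?g t)"
      "(\<Sum>j<cs. of_bool (\<exists>v<vs. v \<in> ?B t \<and> app cs v = j)) = card (col ` ?B t)"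
      "(\<forall>v<vs. v \<in> ?B t \<and> v \<in> X \<longrightarrow> v \<in> Y) \<longleftrightarrow> ?B t \<inter> X \<subseteq> Y"
      "(\<forall>u<vs. \<forall>v<vs. (u \<in> ?B t \<and> u \<in> X \<and> u \<notin> Y) \<and> (v \<in> ?B t \<and> v \<in> X \<and> v \<notin> Y) \<longrightarrow> u = v) \<longleftrightarrow>
        card (?B t \<inter> X - Y) \<le> 1"
    if sub: "?B t \<subseteq> verts H" "?g t \<subseteq> ?B t" for t X Y
  proof -
    have B: "\<forall>v\<in>?B t. v < vs" using sub less by auto
    show "(\<forall>u<vs. \<forall>v<vs. u \<in> ?B t \<and> v \<in> ?B t \<and> prod_encode (u, v) \<in> set_decode es \<longrightarrow>
          u \<in> ?g t \<or> v \<in> ?g t) \<longleftrightarrow> (\<forall>u\<in>?B t. \<forall>v\<in>?B t. {u, v} \<in> edges H \<longrightarrow> u \<in> ?g t \<or> v \<in> ?g t)"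
      unfolding E using B by blast
    have "{..<vs} \<inter> {v. v \<in> ?g t} = ?g t" using B sub by auto
    then show "(\<Sum>v<vs. of_bool (v \<in> ?g t)) = card (?g t)" by simp
    have "{..<cs} \<inter> {j. \<exists>v<vs. v \<in> ?B t \<and> app cs v = j} = col ` ?B t"
    proof
      show "{..<cs} \<inter> {j. \<exists>v<vs. v \<in> ?B t \<and> app cs v = j} \<subseteq> col ` ?B t"
        using C sub(1) by (auto intro!: image_eqI)
      show "col ` ?B t \<subseteq> {..<cs} \<inter> {j. \<exists>v<vs. v \<in> ?B t \<and> app cs v = j}"
        using C Cless sub(1) B by blast
    qed
    then show "(\<Sum>j<cs. of_bool (\<exists>v<vs. v \<in> ?B t \<and> app cs v = j)) = card (col ` ?B t)" by simp
    show "(\<forall>v<vs. v \<in> ?B t \<and> v \<in> X \<longrightarrow> v \<in> Y) \<longleftrightarrow> ?B t \<inter> X \<subseteq> Y" using B by blast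
    have "card (?B t \<inter> X - Y) \<le> 1 \<longleftrightarrow> (\<forall>u\<in>?B t \<inter> X - Y. \<forall>v\<in>?B t \<inter> X - Y. u = v)"
      by (simp add: card_le_Suc0_iff_eq)
    then show "(\<forall>u<vs. \<forall>v<vs. (u \<in> ?B t \<and> u \<in> X \<and> u \<notin> Y) \<and> (v \<in> ?B t \<and> v \<in> X \<and> v \<notin> Y) \<longrightarrow> u = v) \<longleftrightarrow>
        card (?B t \<inter> X - Y) \<le> 1" using B by blast
  qed
  have cover: "(\<forall>u<vs. \<forall>v<vs. u \<in> verts H \<and> v \<in> verts H \<and>
        (prod_encode (u, v) \<in> set_decode es \<or> app cs u = app cs v) \<longrightarrow> (\<exists>t<n. u \<in> ?B t \<and> v \<in> ?B t)) \<longleftrightarrow>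
     (\<forall>u\<in>verts H. \<forall>v\<in>verts H. {u, v} \<in> edges H \<or> col u = col v \<longrightarrow> (\<exists>t<n. u \<in> ?B t \<and> v \<in> ?B t))"
    unfolding E V using less C by (metis (no_types, lifting))
  have sub: "(\<forall>v\<in>A. v \<in> A') \<longleftrightarrow> A \<subseteq> A'" for A A' :: "nat set" by blast
  \<comment> \<open>The equivalences in \<open>node\<close> presuppose the two inclusions of
    \<open>sub\<close>; \<open>conj_cong\<close> supplies them because they are the first
    conjuncts.\<close>
  show ?thesis
    unfolding check_def ordered_guarded_def vs_def[symmetric] es_def[symmetric] cs_def[symmetric]
      cover all sub V
    by (intro conj_cong refl all_cong imp_cong) (simp_all only: node)
qed

section \<open>The output code\<close>

text \<open>\<open>list_encode\<close> and \<open>set_encode\<close> are written out as nested pairs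
  and sums of powers of two. Each edge enters in both orientations, as in
  \<open>encode_graph\<close>, and the factor \<open>of_bool (0 < t)\<close> skips the root 0, which
  has no parent.\<close>

definition decomposition_code :: "nat \<Rightarrow> nat \<Rightarrow> nat \<Rightarrow> nat \<Rightarrow> nat" where
  "decomposition_code n P B g =
     Suc (prod_encode (prod_encode (\<Sum>t<n. 2 ^ t, \<Sum>t<n. of_bool (0 < t) *
         (2 ^ prod_encode (t, app P t) + 2 ^ prod_encode (app P t, t))),
       Suc (prod_encode (0,
         Suc (prod_encode (\<Sum>t<n. 2 ^ prod_encode (t, app B t),
           Suc (prod_encode (\<Sum>t<n. 2 ^ prod_encode (t, app g t), 0))))))))"

lemma encode_map_lessThan: "encode_map {..<n} f = (\<Sum>t<n. 2 ^ prod_encode (t, f t))"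
  unfolding encode_map_def set_encode_def by (subst sum.reindex) (auto simp: inj_on_def)

lemma encode_decomposition_ordered_tree:
  assumes p: "\<And>t. 0 < t \<Longrightarrow> t < n \<Longrightarrow> app P t < t"
  shows "encode_decomposition (ordered_tree n (app P)) 0
    (\<lambda>t. set_decode (app B t)) (\<lambda>t. set_decode (app g t)) = decomposition_code n P B g"
proof -
  let ?T = "ordered_tree n (app P)"
  have vT: "verts ?T = {..<n}" by (simp add: ordered_tree_def)
  have V: "set_encode {..<n} = (\<Sum>t<n. 2 ^ t)" by (simp add: set_encode_def)
  let ?A = "(\<lambda>t. prod_encode (t, app P t)) ` {0<..<n}" and ?A' = "(\<lambda>t. prod_encode (app P t, t)) ` {0<..<n}"
  have "{prod_encode (u, v) | u v. {u, v} \<in> edges ?T} = ?A \<union> ?A'"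
    by (auto simp: ordered_tree_def doubleton_eq_iff image_iff)
  \<comment> \<open>Since parents precede children, no pair occurs in both orientations, so no power
    of two is added twice.\<close>
  moreover have "?A \<inter> ?A' = {}"
  proof -
    have "prod_encode (t, app P t) \<noteq> prod_encode (app P s, s)" if "t \<in> {0<..<n}" "s \<in> {0<..<n}" for s t
      using p[of t] p[of s] that by auto
    then show ?thesis by blast
  qed
  ultimately have "set_encode {prod_encode (u, v) | u v. {u, v} \<in> edges ?T} =
      (\<Sum>x\<in>?A. 2 ^ x) + (\<Sum>x\<in>?A'. 2 ^ x)"
    by (simp add: set_encode_def sum.union_disjoint)
  also have "\<dots> = (\<Sum>t\<in>{0<..<n}. 2 ^ prod_encode (t, app P t) + 2 ^ prod_encode (app P t, t))"
    by (subst (1 2) sum.reindex) (auto simp: inj_on_def sum.distrib)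
  also have "\<dots> = (\<Sum>t<n. of_bool (0 < t) * (2 ^ prod_encode (t, app P t) + 2 ^ prod_encode (app P t, t)))"
    by (rule sum.mono_neutral_cong_left) auto
  finally show ?thesis
    by (simp add: encode_decomposition_def decomposition_code_def encode_graph_def encode_map_lessThan
        vT V)
qed

section \<open>The search and its result\<close>

text \<open>The input is decomposed by guessing its parts below \<open>x\<close>, which avoids
  programs for inverting the pairing.\<close>

definition search :: "nat \<Rightarrow> nat \<Rightarrow> nat \<Rightarrow> nat \<Rightarrow> bool" where
  "search x w c m \<longleftrightarrow> (\<exists>vs<Suc x. \<exists>es<Suc x. \<exists>cs<Suc x.
     x = prod_encode (prod_encode (vs, es), cs) \<and>
     check vs es cs (24 * ((c + w) * w)) (app m 0) (app m 1) (app m 2) (app m 3))"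

lemma decidable_search:
  "decidable (Suc 3) (\<lambda>e. search (hd (tl e)) (hd (tl (tl e))) (hd (tl (tl (tl e)))) (hd e))"
  unfolding search_def check_def by (intro comp_intros; simp)

lemma computable_decomposition_code:
  "computable 1 (\<lambda>e. decomposition_code (app (hd e) 0) (app (hd e) 1) (app (hd e) 2) (app (hd e) 3))"
  unfolding decomposition_code_def by (intro comp_intros; simp)

lemma search_iff:
  assumes "simple_graph H"
  shows "search (encode_colored_graph H col) w c m \<longleftrightarrow>
    ordered_guarded H col (24 * ((c + w) * w)) (app m 0) (app (app m 1))
      (\<lambda>t. set_decode (app (app m 2) t)) (\<lambda>t. set_decode (app (app m 3) t))"
proof -
  have "search (prod_encode (prod_encode (vs, es), cs)) w c m \<longleftrightarrow>
    check vs es cs (24 * ((c + w) * w)) (app m 0) (app m 1) (app m 2) (app m 3)"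
    for vs es cs
  proof -
    have "vs \<le> prod_encode (prod_encode (vs, es), cs)" "es \<le> prod_encode (prod_encode (vs, es), cs)"
      "cs \<le> prod_encode (prod_encode (vs, es), cs)"
      by (meson le_prod_encode_1 le_prod_encode_2 order_trans)+
    then show ?thesis unfolding search_def by (auto simp: less_Suc_eq_le)
  qed
  then show ?thesis
    by (simp add: encode_colored_graph_def encode_graph_def check_iff[OF assms])
qed

lemma ex_search:
  assumes "simple_graph H" "ordered_guarded H col (24 * ((c + w) * w)) n p B g"
  shows "\<exists>m. search (encode_colored_graph H col) w c m"
proof -
  define F where "F = [n, encode_map {..<n} p, encode_map {..<n} (\<lambda>t. set_encode (B t)),
    encode_map {..<n} (\<lambda>t. set_encode (g t))]"
  \<comment> \<open>The four numbers form a table on the indices 0 to 3, so that \<open>app\<close>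
    also serves as the projection.\<close>
  define m where "m = encode_map {..<4} (\<lambda>i. F ! i)"
  have m: "app m 0 = n" "app m 1 = encode_map {..<n} p"
    "app m 2 = encode_map {..<n} (\<lambda>t. set_encode (B t))"
    "app m 3 = encode_map {..<n} (\<lambda>t. set_encode (g t))"
    by (simp_all add: m_def app_encode_map F_def)
  have "finite (B t)" "finite (g t)" if "t < n" for t
    using assms that unfolding ordered_guarded_def simple_graph_def
    by (meson finite_subset)+
  then have "ordered_guarded H col (24 * ((c + w) * w)) n (app (app m 1))
      (\<lambda>t. set_decode (app (app m 2) t)) (\<lambda>t. set_decode (app (app m 3) t))"
    by (intro ordered_guarded_cong[OF assms(2)]) (simp_all add: m[unfolded One_nat_def] app_encode_map)
  then show ?thesis using search_iff[OF assms(1), of col w c m] m(1) by auto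
qed

theorem theorem6p3:
  "\<exists>(K :: nat) (alg :: prog). \<forall>(H :: nat ugraph) (col :: nat \<Rightarrow> nat) (w :: nat) (c :: nat).
     simple_graph H \<longrightarrow> 1 \<le> w \<longrightarrow> treewidth (hat H col) \<le> w \<longrightarrow>
     (\<forall>i\<in>colors H col. \<not> (\<exists>P. is_flower H col c i P)) \<longrightarrow>
     (\<exists>(T :: nat ugraph) r \<beta> g.
        computes alg [encode_colored_graph H col, w, c] (encode_decomposition T r \<beta> g) \<and>
        guarded_cutvertex_decomposition H col T r \<beta> g \<and>
        guard_size T g \<le> K * ((w + c)\<^sup>2 * w\<^sup>2) \<and>
        (\<forall>t\<in>verts T. card (col ` \<beta> t) \<le> K * ((c + w) * w)))"
proof -
  obtain q where *: "\<forall>e. length e = 3 \<longrightarrow> (\<exists>m. search (hd e) (hd (tl e)) (hd (tl (tl e))) m) \<longrightarrow>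
      computes q e (LEAST m. search (hd e) (hd (tl e)) (hd (tl (tl e))) m)"
    using ex_least_program[of 3 "\<lambda>e. search (hd e) (hd (tl e)) (hd (tl (tl e)))",
        OF decidable_search] by blast
  have q: "computes q [x, w, c] (LEAST m. search x w c m)" if "\<exists>m. search x w c m" for x w c
    using *[rule_format, of "[x, w, c]"] that by simp
  obtain f where f: "\<And>m. computes f [m] (decomposition_code (app m 0) (app m 1) (app m 2) (app m 3))"
  proof -
    from computable_decomposition_code obtain f where "\<forall>e. length e = 1 \<longrightarrow> computes f e
        (decomposition_code (app (hd e) 0) (app (hd e) 1) (app (hd e) 2) (app (hd e) 3))"
      unfolding computable_def by blast
    from this[rule_format, of "[m]" for m] that[of f] show thesis by simp
  qed
  show ?thesis
  proof (intro exI[of _ 24] exI[of _ "Comp f [q]"] allI impI)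
    fix H :: "nat ugraph" and col :: "nat \<Rightarrow> nat" and w c :: nat
    assume H: "simple_graph H" and w: "1 \<le> w" "treewidth (hat H col) \<le> w"
      and flower: "\<forall>i\<in>colors H col. \<not> (\<exists>P. is_flower H col c i P)"
    define x where "x = encode_colored_graph H col"
    have ex: "\<exists>m. search x w c m"
      using ex_ordered_guarded[OF H w flower] ex_search[OF H] unfolding x_def by metis
    define m where "m = (LEAST m. search x w c m)"
    let ?T = "ordered_tree (app m 0) (app (app m 1))"
    let ?B = "\<lambda>t. set_decode (app (app m 2) t)" and ?g = "\<lambda>t. set_decode (app (app m 3) t)"
    have "search x w c m" unfolding m_def using ex by (rule LeastI_ex)
    then have og: "ordered_guarded H col (24 * ((c + w) * w)) (app m 0) (app (app m 1)) ?B ?g"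
      using search_iff[OF H] by (simp add: x_def)
    have "computes (Comp f [q]) [x, w, c] (decomposition_code (app m 0) (app m 1) (app m 2) (app m 3))"
      using q[OF ex] by (intro computes.intros(4)[OF _ f[of m]]) (simp add: m_def)
    moreover have "decomposition_code (app m 0) (app m 1) (app m 2) (app m 3) = encode_decomposition ?T 0 ?B ?g"
      using og by (intro encode_decomposition_ordered_tree[symmetric]) (auto simp: ordered_guarded_def)
    \<comment> \<open>The guards satisfy the stronger bound without squares; a natural number never
      exceeds its square.\<close>
    moreover have "24 * ((c + w) * w) \<le> 24 * ((w + c)\<^sup>2 * w\<^sup>2)"
      by (simp add: power2_eq_square add.commute mult_le_mono)
    ultimately show "\<exists>(T :: nat ugraph) r \<beta> g.
        computes (Comp f [q]) [encode_colored_graph H col, w, c] (encode_decomposition T r \<beta> g) \<and>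
        guarded_cutvertex_decomposition H col T r \<beta> g \<and>
        guard_size T g \<le> 24 * ((w + c)\<^sup>2 * w\<^sup>2) \<and>
        (\<forall>t\<in>verts T. card (col ` \<beta> t) \<le> 24 * ((c + w) * w))"
      using ordered_guarded_decomposition[OF H og] unfolding x_def
      by - (rule exI[of _ ?T], rule exI[of _ 0], rule exI[of _ ?B], rule exI[of _ ?g], auto)
  qed
qed

end
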